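(* Let $d\geq 2$. There exist a smooth function $\varphi\colon S^{d-1}\to\mathbb{R}$ on the unit sphere of $\mathbb{R}^d$ and constants $C>0$, $\lambda_0>0$ such that for every $p\in(1,\infty)$ and every real $\lambda$ with $|\lambda|\geq\lambda_0$, $$\|A_\lambda\|_{L_p(\mathbb{R}^d)\to L_p(\mathbb{R}^d)}\geq C\,|\lambda|^{d\left|\frac12-\frac1p\right|}.$$
   Context: For a smooth real-valued function $\varphi$ on the unit sphere $S^{d-1}\subset\mathbb{R}^d$ and $\lambda\in\mathbb{R}$, $A_\lambda$ denotes the Fourier multiplier on $\mathbb{R}^d$ with symbol $\xi\mapsto e^{i\lambda\varphi(\xi/|\xi|)}$, $\xi\neq 0$, that is, $\widehat{A_\lambda f}(\xi)=e^{i\lambda\varphi(\xi/|\xi|)}\hat f(\xi)$ (initially for $f\in L_2\cap L_p$), where $\hat f(\xi)=\int_{\mathbb{R}^d}f(x)e^{-2\pi i\langle x,\xi\rangle}\,dx$. The quantity $\|A_\lambda\|_{L_p\to L_p}$ is its operator norm on $L_p(\mathbb{R}^d)$, i.e. the supremum of $\|A_\lambda f\|_{L_p}/\|f\|_{L_p}$ over nonzero $f\in L_2\cap L_p$. *)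

theory Defs
  imports "HOL-Analysis.Analysis"
begin

text \<open>
  For open \<open>U\<close> in a finite-dimensional space, \<open>Ck_on k U f\<close> says that \<open>f\<close> is \<open>k\<close> times
  continuously differentiable on \<open>U\<close>, expressed by iterated directional derivatives.
\<close>

primrec Ck_on :: "nat \<Rightarrow> 'a::euclidean_space set \<Rightarrow> ('a \<Rightarrow> real) \<Rightarrow> bool" where
  "Ck_on 0 U f \<longleftrightarrow> continuous_on U f"
| "Ck_on (Suc k) U f \<longleftrightarrow>
     (\<forall>x\<in>U. f differentiable (at x)) \<and>
     (\<forall>v. Ck_on k U (\<lambda>x. frechet_derivative f (at x) v))"

text \<open>
  Smoothness on an arbitrary subset, such as an embedded submanifold: locally the
  restriction of a smooth function on an open subset of the ambient space. Only the values
  of \<open>f\<close> on \<open>S\<close> matter.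
\<close>

definition smooth_on :: "'a::euclidean_space set \<Rightarrow> ('a \<Rightarrow> real) \<Rightarrow> bool" where
  "smooth_on S f \<longleftrightarrow>
     (\<forall>x\<in>S. \<exists>U g. open U \<and> x \<in> U \<and> (\<forall>k. Ck_on k U g) \<and> (\<forall>y\<in>U \<inter> S. g y = f y))"

text \<open>
  The \<open>L\<^sub>p\<close> norm for \<open>0 < p < \<infinity>\<close>, with value \<open>\<infinity>\<close> when \<open>\<bar>f\<bar>\<^sup>p\<close> is not integrable. The case
  distinction is needed because \<open>powr\<close> is not available on \<^typ>\<open>ennreal\<close>.
\<close>

definition Lp_norm :: "real \<Rightarrow> ('a::euclidean_space \<Rightarrow> complex) \<Rightarrow> ennreal" where
  "Lp_norm p f =
     (let I = (\<integral>\<^sup>+x. ennreal (cmod (f x) powr p) \<partial>lborel)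
      in if I = \<infinity> then \<infinity> else ennreal (enn2real I powr (1 / p)))"

definition Lp_space :: "real \<Rightarrow> ('a::euclidean_space \<Rightarrow> complex) set" where
  "Lp_space p = {f. f \<in> borel_measurable lborel \<and> Lp_norm p f < \<infinity>}"

definition fourier_integral ::
  "('a::euclidean_space \<Rightarrow> complex) \<Rightarrow> 'a \<Rightarrow> complex" where
  "fourier_integral f \<xi> =
     (\<integral>x. f x * exp (- 2 * of_real pi * \<i> * of_real (x \<bullet> \<xi>)) \<partial>lborel)"

text \<open>
  \<open>fourier_L2 f F\<close> says that \<open>F\<close> is (a representative of) the Fourier transform of
  \<open>f \<in> L\<^sub>2\<close>, i.e. of the \<open>L\<^sub>2\<close>-continuous extension of the Fourier integral
  from \<open>L\<^sub>1 \<inter> L\<^sub>2\<close>. By Plancherel's theorem such an \<open>F\<close> exists for every \<open>f \<in> L\<^sub>2\<close> and is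
  unique up to null sets.
\<close>

definition fourier_L2 ::
  "('a::euclidean_space \<Rightarrow> complex) \<Rightarrow> ('a \<Rightarrow> complex) \<Rightarrow> bool" where
  "fourier_L2 f F \<longleftrightarrow>
     f \<in> Lp_space 2 \<and> F \<in> Lp_space 2 \<and>
     (\<exists>h :: nat \<Rightarrow> 'a \<Rightarrow> complex.
        (\<forall>n. h n \<in> Lp_space 1 \<inter> Lp_space 2) \<and>
        (\<lambda>n. Lp_norm 2 (\<lambda>x. h n x - f x)) \<longlonglongrightarrow> 0 \<and>
        (\<lambda>n. Lp_norm 2 (\<lambda>\<xi>. fourier_integral (h n) \<xi> - F \<xi>)) \<longlonglongrightarrow> 0)"

text \<open>
  \<open>fourier_multiplier m f g\<close> says that \<open>g\<close> is (a representative of) the image of \<open>f\<close>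
  under the Fourier multiplier on \<open>L\<^sub>2\<close> with bounded measurable symbol \<open>m\<close>.
\<close>

definition fourier_multiplier ::
  "('a::euclidean_space \<Rightarrow> complex) \<Rightarrow> ('a \<Rightarrow> complex) \<Rightarrow> ('a \<Rightarrow> complex) \<Rightarrow> bool" where
  "fourier_multiplier m f g \<longleftrightarrow>
     (\<exists>F. fourier_L2 f F \<and> fourier_L2 g (\<lambda>\<xi>. m \<xi> * F \<xi>))"

text \<open>
  The supremum ranges over \<open>f\<close> that are nonzero as elements of \<open>L\<^sub>p\<close>; it is
  \<open>\<infinity>\<close> if the multiplier is unbounded on \<open>L\<^sub>p\<close>.
\<close>

definition multiplier_norm ::
  "real \<Rightarrow> ('a::euclidean_space \<Rightarrow> complex) \<Rightarrow> ennreal" where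
  "multiplier_norm p m =
     Sup {Lp_norm p g / Lp_norm p f | f g.
            f \<in> Lp_space 2 \<inter> Lp_space p \<and> Lp_norm p f \<noteq> 0 \<and> fourier_multiplier m f g}"

text \<open>The value at \<open>\<xi> = 0\<close> is irrelevant, since a single point is a null set.\<close>

definition phase_symbol ::
  "('a::euclidean_space \<Rightarrow> real) \<Rightarrow> real \<Rightarrow> 'a \<Rightarrow> complex" where
  "phase_symbol \<phi> l \<xi> = exp (\<i> * of_real (l * \<phi> (\<xi> /\<^sub>R norm \<xi>)))"

end

theory Submission
  imports Defs "HOL-Probability.Characteristic_Functions"
begin

text \<open>
  Fix a direction \<open>e\<close> and put \<open>t = \<xi> \<bullet> e\<close>. Near \<open>e\<close> the phase is
  \<open>\<xi>\<^sub>2 / t + (\<Sum>j\<ge>3. \<xi>\<^sub>j\<^sup>2 / t\<^sup>2)\<close>, which is homogeneous of degree zero and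
  nevertheless has a nondegenerate Hessian in all \<open>d\<close> variables (Euler's identity permits
  this wherever the gradient does not vanish). For a fixed
  compactly supported frequency profile \<open>F\<close>, the inverse transform \<open>g\<^sub>\<lambda>\<close> of \<open>e\<^sup>i\<^sup>\<lambda>\<^sup>\<phi> F\<close>
  is therefore \<open>O(\<bar>\<lambda>\<bar>\<^sup>-\<^sup>d\<^sup>/\<^sup>2)\<close> uniformly: the \<open>d - 2\<close> quadratic variables
  contribute \<open>\<bar>\<lambda>\<bar>\<^sup>-\<^sup>1\<^sup>/\<^sup>2\<close> each, and the linear one concentrates \<open>\<lambda> / t\<close>
  in a bounded window, which costs \<open>\<bar>\<lambda>\<bar>\<^sup>-\<^sup>1\<close> after integrating in \<open>t\<close>. The \<open>L\<^sub>2\<close> norm of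
  \<open>g\<^sub>\<lambda>\<close> does not depend on \<open>\<lambda>\<close>, so interpolating between \<open>L\<^sub>2\<close> and \<open>L\<^sub>\<infinity>\<close> makes
  its \<open>L\<^sub>p\<close> norm large for \<open>p \<le> 2\<close> and small for \<open>p \<ge> 2\<close>. Hence
  \<open>g\<^sub>0 \<mapsto> g\<^sub>\<lambda>\<close> gives the bound for \<open>p \<le> 2\<close>, and \<open>g\<^sub>-\<^sub>\<lambda> \<mapsto> g\<^sub>0\<close> for \<open>p \<ge> 2\<close>.
\<close>

section \<open>Closure properties of \<^const>\<open>Ck_on\<close> and the phase\<close>

lemma Ck_on_SucD:
  assumes "Ck_on (Suc k) U f" "x \<in> U"
  shows "(f has_derivative frechet_derivative f (at x)) (at x)"
  using assms by (auto simp: frechet_derivative_works[symmetric])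

text \<open>On an open set the Frechet derivative at a point depends only on nearby values, so
  agreement of two functions passes to their derivatives and the induction closes.\<close>

lemma Ck_on_cong:
  assumes "open U" "\<And>x. x \<in> U \<Longrightarrow> f x = g x" "Ck_on k U f"
  shows "Ck_on k U g"
  using assms(2,3)
proof (induction k arbitrary: f g)
  case 0
  then show ?case by (simp cong: continuous_on_cong)
next
  case (Suc k)
  have der: "(g has_derivative frechet_derivative f (at x)) (at x)" if x: "x \<in> U" for x
    by (rule has_derivative_transform_within_open[OF Ck_on_SucD[OF Suc.prems(2) x] assms(1) x])
       (use Suc.prems in auto)
  have eq: "frechet_derivative f (at x) = frechet_derivative g (at x)" if "x \<in> U" for x
    by (rule frechet_derivative_at[OF der[OF that]])
  have "Ck_on k U (\<lambda>x. frechet_derivative g (at x) v)" for v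
  proof (rule Suc.IH)
    show "Ck_on k U (\<lambda>x. frechet_derivative f (at x) v)"
      using Suc.prems(2) by simp
  qed (simp only: eq)
  with der show ?case
    by (auto simp: differentiable_def)
qed

text \<open>Allows an explicit derivative formula in place of \<open>frechet_derivative\<close>; the
  differentiation rules below enter the induction on the order through it.\<close>

lemma Ck_on_SucI:
  assumes "open U" "\<And>x. x \<in> U \<Longrightarrow> (f has_derivative f' x) (at x)"
    and "\<And>v. Ck_on k U (\<lambda>x. f' x v)"
  shows "Ck_on (Suc k) U f"
proof -
  have "f' x = frechet_derivative f (at x)" if "x \<in> U" for x
    by (rule frechet_derivative_at[OF assms(2)[OF that]])
  then have "Ck_on k U (\<lambda>x. frechet_derivative f (at x) v)" for v
    by (intro Ck_on_cong[OF assms(1) _ assms(3)[of v]]) auto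
  then show ?thesis
    using assms(2) by (auto simp: differentiable_def)
qed

lemma Ck_on_Suc_imp: "Ck_on (Suc k) U f \<Longrightarrow> Ck_on k U f"
proof (induction k arbitrary: f)
  case 0
  then show ?case
    by (auto intro!: continuous_at_imp_continuous_on differentiable_imp_continuous_within)
next
  case (Suc k)
  have "Ck_on k U (\<lambda>x. frechet_derivative f (at x) v)" for v
    using Suc.prems by (intro Suc.IH) auto
  with Suc.prems show ?case by auto
qed

lemma Ck_on_const: "Ck_on k U (\<lambda>_. c)"
  by (induction k arbitrary: c) auto

lemma Ck_on_inner: "open U \<Longrightarrow> Ck_on k U (\<lambda>x. x \<bullet> v)"
proof (cases k)
  case (Suc j)
  assume "open U"
  show ?thesis unfolding Suc
    by (rule Ck_on_SucI[OF \<open>open U\<close>, where f'="\<lambda>x h. h \<bullet> v"])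
       (auto intro!: derivative_eq_intros Ck_on_const \<open>open U\<close>)
qed (auto intro!: continuous_intros)

lemma Ck_on_add:
  assumes "open U" "Ck_on k U f" "Ck_on k U g"
  shows "Ck_on k U (\<lambda>x. f x + g x)"
  using assms(2,3)
proof (induction k arbitrary: f g)
  case (Suc k)
  show ?case
    by (rule Ck_on_SucI[OF assms(1) has_derivative_add[OF Ck_on_SucD Ck_on_SucD]])
       (use Suc assms(1) in auto)
qed (auto intro!: continuous_intros)

lemma Ck_on_mult:
  assumes "open U" "Ck_on k U f" "Ck_on k U g"
  shows "Ck_on k U (\<lambda>x. f x * g x)"
  using assms(2,3)
proof (induction k arbitrary: f g)
  case (Suc k)
  show ?case
    by (rule Ck_on_SucI[OF assms(1) has_derivative_mult[OF Ck_on_SucD Ck_on_SucD]])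
       (use Suc assms(1) Ck_on_Suc_imp[OF Suc.prems(1)] Ck_on_Suc_imp[OF Suc.prems(2)]
         in \<open>auto intro!: Ck_on_add Suc.IH\<close>)
qed (auto intro!: continuous_intros)

lemma Ck_on_sum:
  assumes "open U" "\<And>i. i \<in> I \<Longrightarrow> Ck_on k U (f i)"
  shows "Ck_on k U (\<lambda>x. \<Sum>i\<in>I. f i x)"
  using assms(2) by (induction I rule: infinite_finite_induct)
    (auto intro!: Ck_on_const Ck_on_add assms(1))

text \<open>The derivative of 1/f is built from a first derivative of f and from 1/f itself, so
  order k for 1/f yields order k + 1.\<close>

lemma Ck_on_inverse:
  assumes "open U" "Ck_on k U f" "\<And>x. x \<in> U \<Longrightarrow> f x \<noteq> 0"
  shows "Ck_on k U (\<lambda>x. inverse (f x))"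
  using assms(2)
proof (induction k)
  case (Suc k)
  show ?case
  proof (rule Ck_on_SucI[OF assms(1)])
    fix x assume x: "x \<in> U"
    \<comment> \<open>The sign is written as a constant factor, so closure under products covers
      it.\<close>
    show "((\<lambda>x. inverse (f x)) has_derivative
        (\<lambda>h. - 1 * (inverse (f x) * frechet_derivative f (at x) h * inverse (f x)))) (at x)"
      using Ck_on_SucD[OF Suc.prems x] assms(3)[OF x] by (auto intro!: derivative_eq_intros)
  next
    show "Ck_on k U (\<lambda>x. - 1 * (inverse (f x) * frechet_derivative f (at x) v * inverse (f x)))"
      for v
      using Suc.IH[OF Ck_on_Suc_imp[OF Suc.prems]] Suc.prems assms(1)
      by (intro Ck_on_mult Ck_on_const) auto
  qed
qed (use assms(3) in \<open>auto intro!: continuous_intros\<close>)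

section \<open>The flat function and a positive global denominator\<close>

definition flat :: "nat \<Rightarrow> real \<Rightarrow> real" where
  "flat k x = (if x > 0 then exp (- 1 / x) / x ^ k else 0)"

lemma tendsto_flat: "(flat k \<longlongrightarrow> 0) (at 0)"
  unfolding filterlim_split_at
proof (rule filterlim_split_at)
  show "(flat k \<longlongrightarrow> 0) (at_left 0)"
    by (rule tendsto_eventually) (auto simp: flat_def eventually_at_filter)
  have "((\<lambda>x. (inverse x) ^ k / exp (inverse x)) \<longlongrightarrow> (0::real)) (at_right 0)"
    by (rule filterlim_compose[OF tendsto_power_div_exp_0 filterlim_inverse_at_top_right])
  moreover have "\<forall>\<^sub>F x in at_right 0. (inverse x) ^ k / exp (inverse x) = flat k x"
    by (auto simp: flat_def eventually_at_filter exp_minus field_simps power_divide)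
  ultimately show "(flat k \<longlongrightarrow> 0) (at_right 0)"
    by (rule Lim_transform_eventually)
qed

text \<open>Dividing \<open>exp (- 1 / x)\<close> by powers of x gives a family closed under
  differentiation, which is the purpose of the index k; smoothness then follows by induction for all
  k at once.\<close>

lemma DERIV_flat:
  "(flat k has_real_derivative flat (k + 2) x - real k * flat (k + 1) x) (at x)"
proof (cases x "0::real" rule: linorder_cases)
  case less
  have "((\<lambda>_. 0) has_real_derivative 0) (at x)" by simp
  then have "(flat k has_real_derivative 0) (at x)"
    by (rule has_field_derivative_transform_within_open[where S="{..<0}"])
       (use less in \<open>auto simp: flat_def\<close>)
  then show ?thesis using less by (simp add: flat_def)
next
  case equal
  \<comment> \<open>At 0 the difference quotient of \<open>flat k\<close> is
    \<open>flat (k + 1)\<close> on both sides, and this tends to 0.\<close>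
  have "\<forall>\<^sub>F h in at 0. flat (k + 1) h = (flat k (0 + h) - flat k 0) / h"
    by (auto simp: flat_def eventually_at_filter)
  then have "((\<lambda>h. (flat k (0 + h) - flat k 0) / h) \<longlongrightarrow> 0) (at 0)"
    by (rule Lim_transform_eventually[OF tendsto_flat])
  then show ?thesis using equal by (simp add: DERIV_def flat_def)
next
  case greater
  have "((\<lambda>x. exp (- 1 / x) / x ^ k) has_real_derivative
      exp (- 1 / x) / x ^ (k + 2) - real k * (exp (- 1 / x) / x ^ (k + 1))) (at x)"
    using greater
    by (auto intro!: derivative_eq_intros simp: field_simps power2_eq_square)
       (cases k; auto simp: field_simps)
  then have "(flat k has_real_derivative
      exp (- 1 / x) / x ^ (k + 2) - real k * (exp (- 1 / x) / x ^ (k + 1))) (at x)"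
    by (rule has_field_derivative_transform_within_open[where S="{0<..}"])
       (use greater in \<open>auto simp: flat_def\<close>)
  then show ?thesis using greater by (simp add: flat_def)
qed

lemma Ck_on_flat: "Ck_on m UNIV (\<lambda>x. flat k (a - x \<bullet> v))"
proof (induction m arbitrary: k)
  case 0
  have "continuous_on UNIV (flat k)"
    by (meson DERIV_flat DERIV_isCont continuous_at_imp_continuous_on)
  then show ?case
    by (auto intro!: continuous_on_compose2[of UNIV "flat k"] continuous_intros)
next
  case (Suc m)
  show ?case
  proof (rule Ck_on_SucI)
    show "((\<lambda>x. flat k (a - x \<bullet> v)) has_derivative (\<lambda>h. (flat (k + 2) (a - x \<bullet> v) +
        (- real k) * flat (k + 1) (a - x \<bullet> v)) * (- (h \<bullet> v)))) (at x)" for x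
      by (rule DERIV_compose_FDERIV[OF DERIV_flat, THEN has_derivative_eq_rhs])
         (auto intro!: derivative_eq_intros)
  qed (intro Ck_on_mult Ck_on_add Ck_on_const Suc.IH open_UNIV)+
qed

text \<open>
  A smooth positive function on the whole space that agrees with \<open>x \<bullet> e\<close> where
  \<open>x \<bullet> e \<ge> 1 / d\<close>; dividing by it needs no cutoff.
\<close>

definition phase_den :: "'a::euclidean_space \<Rightarrow> 'a \<Rightarrow> real" where
  "phase_den e x = x \<bullet> e + exp (real DIM('a)) *
     ((1 / real DIM('a) - x \<bullet> e) * flat 0 (1 / real DIM('a) - x \<bullet> e))"

text \<open>With t = \<open>x \<bullet> e\<close> and s = 1/d - t, the correction is nonnegative,
  which settles t > 0. For t \<le> 0 one has s \<ge> 1/d, hence exp(-1/s) \<ge> exp(-d); the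
  constant exp(d) therefore makes the correction at least s, and the sum is at least 1/d.\<close>

lemma phase_den_pos: "phase_den e (x::'a::euclidean_space) > 0"
proof -
  define d t where "d = real DIM('a)" and "t = x \<bullet> e"
  have d: "d > 0" by (simp add: d_def)
  have "0 < t + exp d * ((1 / d - t) * flat 0 (1 / d - t))"
  proof (cases "t > 0")
    case True
    moreover have "(1 / d - t) * flat 0 (1 / d - t) \<ge> 0"
      by (auto simp: flat_def)
    ultimately show ?thesis by (simp add: add_pos_nonneg)
  next
    case False
    moreover have "1 / d > 0" using d by simp
    ultimately have s: "1 / d - t \<ge> 1 / d" "1 / d - t > 0" by linarith+
    have "1 / (1 / d - t) \<le> 1 / (1 / d)"
      using s d by (intro divide_left_mono mult_pos_pos) auto
    then have "exp d * exp (- 1 / (1 / d - t)) \<ge> 1"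
      by (simp add: exp_add[symmetric])
    then have "(1 / d - t) * 1 \<le> (1 / d - t) * (exp d * exp (- 1 / (1 / d - t)))"
      using s(2) by (intro mult_left_mono) auto
    then have "exp d * ((1 / d - t) * flat 0 (1 / d - t)) \<ge> 1 / d - t"
      using s(2) by (simp add: flat_def mult_ac)
    moreover have "1 / d > 0" using d by simp
    ultimately show ?thesis by linarith
  qed
  then show ?thesis by (simp add: phase_den_def d_def t_def)
qed

lemma phase_den_eq: "x \<bullet> e \<ge> 1 / real DIM('a) \<Longrightarrow> phase_den e (x::'a::euclidean_space) = x \<bullet> e"
  by (simp add: phase_den_def flat_def)

lemma Ck_on_phase_den: "Ck_on k UNIV (phase_den e)"
proof -
  have "Ck_on k UNIV (\<lambda>x::'a. x \<bullet> e + exp (real DIM('a)) *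
     ((1 / real DIM('a) + (- 1) * (x \<bullet> e)) * flat 0 (1 / real DIM('a) - x \<bullet> e)))"
    by (intro Ck_on_add Ck_on_mult Ck_on_const Ck_on_inner Ck_on_flat) auto
  then show ?thesis
    unfolding phase_den_def[abs_def] by simp
qed

section \<open>The phase function\<close>

definition coord_phase :: "'a \<Rightarrow> 'a \<Rightarrow> real \<Rightarrow> real" where
  "coord_phase e2 b s = (if b = e2 then s else s * s)"

definition phase_fun :: "'a::euclidean_space \<Rightarrow> 'a \<Rightarrow> 'a \<Rightarrow> real" where
  "phase_fun e e2 x = (\<Sum>b\<in>Basis - {e}. coord_phase e2 b (x \<bullet> b * inverse (phase_den e x)))"

lemma smooth_on_phase_fun: "smooth_on S (phase_fun e e2)"
proof -
  have *: "Ck_on k UNIV (\<lambda>x. x \<bullet> b * inverse (phase_den e x))" for k b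
    by (intro Ck_on_mult Ck_on_inverse Ck_on_inner Ck_on_phase_den)
       (auto simp: phase_den_pos less_imp_neq[OF phase_den_pos, symmetric])
  have "Ck_on k UNIV (\<lambda>x. coord_phase e2 b (x \<bullet> b * inverse (phase_den e x)))" for k b
    by (cases "b = e2") (auto simp: coord_phase_def intro!: * Ck_on_mult)
  then have "Ck_on k UNIV (phase_fun e e2)" for k
    unfolding phase_fun_def[abs_def] by (intro Ck_on_sum) auto
  then show ?thesis
    unfolding smooth_on_def by blast
qed

text \<open>Every coordinate is bounded by \<open>x \<bullet> e\<close>, so the norm is at most d
  times \<open>x \<bullet> e\<close>. The normalized vector thus reaches the threshold 1/d beyond
  which \<open>phase_den\<close> is exact, and the norm cancels in the quotients.\<close>

lemma phase_fun_normalized: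
  fixes x :: "'a::euclidean_space"
  assumes e: "e \<in> Basis" and "x \<bullet> e \<ge> 1" and b: "\<And>b. b \<in> Basis - {e} \<Longrightarrow> \<bar>x \<bullet> b\<bar> \<le> 1"
  shows "phase_fun e e2 (x /\<^sub>R norm x) =
    (\<Sum>b\<in>Basis - {e}. coord_phase e2 b (x \<bullet> b / max 1 (x \<bullet> e)))"
proof -
  have "norm x \<le> (\<Sum>b\<in>Basis. \<bar>x \<bullet> b\<bar>)" by (rule norm_le_l1)
  also have "\<dots> \<le> (\<Sum>b\<in>(Basis :: 'a set). x \<bullet> e)"
    using assms(2) b by (intro sum_mono) (metis DiffI abs_of_nonneg empty_iff insert_iff order.refl order.trans zero_le_one)
  finally have n: "norm x \<le> real DIM('a) * (x \<bullet> e)" by simp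
  have "x \<noteq> 0" using assms(2) by auto
  with n have "(x /\<^sub>R norm x) \<bullet> e \<ge> 1 / real DIM('a)"
    by (simp add: field_simps)
  from phase_den_eq[OF this] have "phase_den e (x /\<^sub>R norm x) = (x \<bullet> e) / norm x"
    by (simp add: field_simps)
  then show ?thesis
    using \<open>x \<noteq> 0\<close> assms(2) by (simp add: phase_fun_def max_def field_simps)
qed

section \<open>Gaussians and product integrals\<close>

lemma lborel_integral_affine:
  fixes f :: "'a::euclidean_space \<Rightarrow> complex"
  assumes "c \<noteq> 0" "f \<in> borel_measurable borel"
  shows "(\<integral>x. f x \<partial>lborel) = \<bar>c\<bar> ^ DIM('a) *\<^sub>R (\<integral>x. f (t + c *\<^sub>R x) \<partial>lborel)"
proof -
  have "(\<integral>x. f x \<partial>lborel) = (\<integral>x. f x \<partial>density (distr lborel borel (\<lambda>x. t + c *\<^sub>R x)) (\<lambda>_. \<bar>c\<bar> ^ DIM('a)))"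
    using lborel_affine[OF assms(1), of t] by simp
  also have "\<dots> = \<bar>c\<bar> ^ DIM('a) *\<^sub>R (\<integral>x. f (t + c *\<^sub>R x) \<partial>lborel)"
    using assms by (subst integral_density) (auto simp: integral_distr)
  finally show ?thesis .
qed

lemma nn_integral_lborel_affine:
  fixes f :: "'a::euclidean_space \<Rightarrow> ennreal"
  assumes "c \<noteq> 0" "f \<in> borel_measurable borel"
  shows "(\<integral>\<^sup>+x. f x \<partial>lborel) = ennreal (\<bar>c\<bar> ^ DIM('a)) * (\<integral>\<^sup>+x. f (t + c *\<^sub>R x) \<partial>lborel)"
proof -
  have "(\<integral>\<^sup>+x. f x \<partial>lborel) = (\<integral>\<^sup>+x. f x \<partial>density (distr lborel borel (\<lambda>x. t + c *\<^sub>R x)) (\<lambda>_. \<bar>c\<bar> ^ DIM('a)))"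
    using lborel_affine[OF assms(1), of t] by simp
  also have "\<dots> = ennreal (\<bar>c\<bar> ^ DIM('a)) * (\<integral>\<^sup>+x. f (t + c *\<^sub>R x) \<partial>lborel)"
    using assms by (subst nn_integral_density) (auto simp: nn_integral_distr nn_integral_cmult)
  finally show ?thesis .
qed

lemma integrable_lborel_affine:
  fixes f :: "'a::euclidean_space \<Rightarrow> complex"
  assumes "c \<noteq> 0" "integrable lborel f"
  shows "integrable lborel (\<lambda>x. f (t + c *\<^sub>R x))"
proof (rule integrableI_bounded)
  have [measurable]: "f \<in> borel_measurable borel" using assms(2) by auto
  show "(\<lambda>x. f (t + c *\<^sub>R x)) \<in> borel_measurable lborel" by simp
  have "ennreal (\<bar>c\<bar> ^ DIM('a)) * (\<integral>\<^sup>+x. norm (f (t + c *\<^sub>R x)) \<partial>lborel) = (\<integral>\<^sup>+x. norm (f x) \<partial>lborel)"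
    using assms(1) by (subst nn_integral_lborel_affine[of c _ t]) auto
  also have "\<dots> < \<infinity>" using assms(2) by (simp add: integrable_iff_bounded)
  finally show "(\<integral>\<^sup>+x. norm (f (t + c *\<^sub>R x)) \<partial>lborel) < \<infinity>"
    using assms(1) by (auto simp: ennreal_mult_less_top)
qed

lemma
  fixes f :: "'a::euclidean_space \<Rightarrow> real \<Rightarrow> complex"
  assumes f: "\<And>b. b \<in> Basis \<Longrightarrow> integrable lborel (f b)"
  shows integrable_lborel_prod: "integrable lborel (\<lambda>x. \<Prod>b\<in>Basis. f b (x \<bullet> b))"
    and integral_lborel_prod:
      "(\<integral>x. (\<Prod>b\<in>Basis. f b (x \<bullet> b)) \<partial>lborel) = (\<Prod>b\<in>Basis. \<integral>s. f b s \<partial>lborel)"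
proof -
  interpret product_sigma_finite "\<lambda>_::'a. lborel :: real measure" ..
  have m: "(\<lambda>x. \<Prod>b\<in>Basis. f b (x \<bullet> b)) \<in> borel_measurable borel"
  proof (rule borel_measurable_prod)
    fix b :: 'a assume "b \<in> Basis"
    then have [measurable]: "f b \<in> borel_measurable borel" using f by auto
    show "(\<lambda>x. f b (x \<bullet> b)) \<in> borel_measurable borel" by measurable
  qed
  have *: "(\<Prod>b\<in>Basis. f b ((\<Sum>b\<in>Basis. y b *\<^sub>R b) \<bullet> b)) = (\<Prod>b\<in>Basis. f b (y b))" for y
    by (intro prod.cong) auto
  show "integrable lborel (\<lambda>x. \<Prod>b\<in>Basis. f b (x \<bullet> b))"
    by (subst lborel_eq, subst integrable_distr_eq)
       (use m f in \<open>auto simp: * intro!: product_integrable_prod\<close>)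
  show "(\<integral>x. (\<Prod>b\<in>Basis. f b (x \<bullet> b)) \<partial>lborel) = (\<Prod>b\<in>Basis. \<integral>s. f b s \<partial>lborel)"
    by (subst lborel_eq, subst integral_distr)
       (use m f in \<open>auto simp: * product_integral_prod\<close>)
qed

text \<open>Fubini with the coordinate t along e integrated last. The remaining factors may depend
  on t, but for frozen t they form a product, so the inner integral splits. This matches the phase,
  whose coordinates are coupled only through division by t.\<close>

lemma integral_lborel_split:
  fixes u :: "real \<Rightarrow> complex" and v :: "'a::euclidean_space \<Rightarrow> real \<Rightarrow> real \<Rightarrow> complex"
  assumes e: "e \<in> Basis"
    and int: "integrable lborel (\<lambda>x. u (x \<bullet> e) * (\<Prod>b\<in>Basis - {e}. v b (x \<bullet> e) (x \<bullet> b)))"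
    and v: "\<And>b t. b \<in> Basis - {e} \<Longrightarrow> integrable lborel (v b t)"
    and m: "(\<lambda>t. u t * (\<Prod>b\<in>Basis - {e}. \<integral>s. v b t s \<partial>lborel)) \<in> borel_measurable borel"
  shows "(\<integral>x. u (x \<bullet> e) * (\<Prod>b\<in>Basis - {e}. v b (x \<bullet> e) (x \<bullet> b)) \<partial>lborel) =
    (\<integral>t. u t * (\<Prod>b\<in>Basis - {e}. \<integral>s. v b t s \<partial>lborel) \<partial>lborel)"
proof -
  interpret product_sigma_finite "\<lambda>_::'a. lborel :: real measure" ..
  define B where "B = (Basis - {e} :: 'a set)"
  have B: "Basis = {e} \<union> B" "{e} \<inter> B = {}" "finite B" using e by (auto simp: B_def)
  let ?f = "\<lambda>x::'a. u (x \<bullet> e) * (\<Prod>b\<in>B. v b (x \<bullet> e) (x \<bullet> b))"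
  let ?T = "\<lambda>y. \<Sum>b\<in>Basis. y b *\<^sub>R (b::'a)"
  have mf: "?f \<in> borel_measurable borel" using borel_measurable_integrable[OF int] by (simp add: B_def)
  have T: "?T \<in> measurable (\<Pi>\<^sub>M b\<in>Basis. lborel) borel" by measurable
  have fT: "?f (?T y) = u (y e) * (\<Prod>b\<in>B. v b (y e) (y b))" for y
    using e by (auto simp: B_def intro!: prod.cong)
  have "(\<integral>x. ?f x \<partial>lborel) = (\<integral>y. ?f (?T y) \<partial>(\<Pi>\<^sub>M b\<in>Basis. lborel))"
    by (subst lborel_eq, subst integral_distr[OF T mf]) simp
  also have "\<dots> = (\<integral>y. u (y e) * (\<Prod>b\<in>B. v b (y e) (y b)) \<partial>(\<Pi>\<^sub>M b\<in>{e} \<union> B. lborel))"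
    by (simp only: fT B(1)[symmetric])
  also have "\<dots> = (\<integral>x. (\<integral>y. u (x e) * (\<Prod>b\<in>B. v b (x e) (y b)) \<partial>(\<Pi>\<^sub>M b\<in>B. lborel)) \<partial>(\<Pi>\<^sub>M b\<in>{e}. lborel))"
  proof (subst product_integral_fold)
    have "integrable (\<Pi>\<^sub>M b\<in>Basis. lborel) (\<lambda>y. ?f (?T y))"
      using int mf unfolding B_def[symmetric]
      by (subst (asm) lborel_eq, subst (asm) integrable_distr_eq[OF T]) auto
    then show "integrable (\<Pi>\<^sub>M b\<in>{e} \<union> B. lborel) (\<lambda>y. u (y e) * (\<Prod>b\<in>B. v b (y e) (y b)))"
      by (simp only: fT B(1)[symmetric])
    have "(\<Prod>b\<in>B. v b (merge {e} B (x, y) e) (merge {e} B (x, y) b)) = (\<Prod>b\<in>B. v b (x e) (y b))" for x y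
      using B(2) by (intro prod.cong) (auto simp: merge_def)
    then show "(\<integral>x. (\<integral>y. u (merge {e} B (x, y) e) * (\<Prod>b\<in>B. v b (merge {e} B (x, y) e) (merge {e} B (x, y) b)) \<partial>(\<Pi>\<^sub>M b\<in>B. lborel)) \<partial>(\<Pi>\<^sub>M b\<in>{e}. lborel)) =
      (\<integral>x. (\<integral>y. u (x e) * (\<Prod>b\<in>B. v b (x e) (y b)) \<partial>(\<Pi>\<^sub>M b\<in>B. lborel)) \<partial>(\<Pi>\<^sub>M b\<in>{e}. lborel))"
      by (simp add: merge_def)
  qed (use B in auto)
  also have "\<dots> = (\<integral>x. u (x e) * (\<Prod>b\<in>B. \<integral>s. v b (x e) s \<partial>lborel) \<partial>(\<Pi>\<^sub>M b\<in>{e}. lborel))"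
    using B(3) v by (subst integral_mult_right_zero, subst product_integral_prod) (auto simp: B_def)
  also have "\<dots> = (\<integral>t. u t * (\<Prod>b\<in>B. \<integral>s. v b t s \<partial>lborel) \<partial>lborel)"
    using m by (subst product_integral_singleton[symmetric]) (auto simp: B_def)
  finally show ?thesis by (simp add: B_def)
qed

section \<open>The standard Gaussian and its Fourier transform\<close>

definition gauss :: "'a::euclidean_space \<Rightarrow> real" where
  "gauss x = (\<Prod>b\<in>Basis. std_normal_density (x \<bullet> b))"

lemma gauss_eq:
  "gauss (x::'a::euclidean_space) = (1 / sqrt (2 * pi)) ^ DIM('a) * exp (- (norm x)\<^sup>2 / 2)"
proof -
  have "(norm x)\<^sup>2 = (\<Sum>b\<in>Basis. (x \<bullet> b)\<^sup>2)"
    by (simp add: norm_eq_sqrt_inner euclidean_inner[of x x] power2_eq_square sum_nonneg)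
  then show ?thesis
    by (simp add: gauss_def std_normal_density_def prod_dividef exp_sum[symmetric] sum_negf
        sum_divide_distrib prod.distrib power_one_over)
qed

lemma gauss_nonneg: "gauss x \<ge> 0"
  by (simp add: gauss_def prod_nonneg)

lemma gauss_measurable [measurable]: "gauss \<in> borel_measurable borel"
  unfolding gauss_def[abs_def] by measurable

text \<open>Integrand and value both factor over the coordinates; each factor is the characteristic
  function of the standard normal distribution.\<close>

lemma
  fixes y :: "'a::euclidean_space"
  shows integrable_gauss_exp: "integrable lborel (\<lambda>x. of_real (gauss x) * exp (\<i> * of_real (x \<bullet> y)))"
    and integral_gauss_exp:
      "(\<integral>x. of_real (gauss x) * exp (\<i> * of_real (x \<bullet> y)) \<partial>lborel) = of_real (exp (- (norm y)\<^sup>2 / 2))"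
proof -
  let ?f = "\<lambda>b s. of_real (std_normal_density s) * exp (\<i> * of_real (s * (y \<bullet> b)))"
  have int: "integrable lborel (?f b)" for b
    by (rule Bochner_Integration.integrable_bound[OF integrable_normal_density[of 1 0]])
       (auto simp: norm_mult)
  have eq: "(\<Prod>b\<in>Basis. ?f b (x \<bullet> b)) = of_real (gauss x) * exp (\<i> * of_real (x \<bullet> y))" for x
    by (simp add: gauss_def prod.distrib exp_sum[symmetric] euclidean_inner[of x y] sum_distrib_left)
  have char: "(\<integral>s. ?f b s \<partial>lborel) = of_real (exp (- (y \<bullet> b)\<^sup>2 / 2))" for b
  proof -
    have "(\<integral>s. ?f b s \<partial>lborel) = char std_normal_distribution (y \<bullet> b)"
      unfolding char_def
      by (subst integral_density) (auto simp: scaleR_conv_of_real mult_ac)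
    then show ?thesis by (simp add: char_std_normal_distribution)
  qed
  show "integrable lborel (\<lambda>x. of_real (gauss x) * exp (\<i> * of_real (x \<bullet> y)))"
    using integrable_lborel_prod[of ?f, OF int] by (simp only: eq)
  have "(norm y)\<^sup>2 = (\<Sum>b\<in>Basis. (y \<bullet> b)\<^sup>2)"
    by (simp add: norm_eq_sqrt_inner euclidean_inner[of y y] power2_eq_square sum_nonneg)
  then have *: "of_real (exp (- (norm y)\<^sup>2 / 2)) = (\<Prod>b\<in>Basis. complex_of_real (exp (- (y \<bullet> b)\<^sup>2 / 2)))"
    by (simp only: of_real_prod[symmetric]) (simp add: exp_sum[symmetric] sum_negf sum_divide_distrib)
  show "(\<integral>x. of_real (gauss x) * exp (\<i> * of_real (x \<bullet> y)) \<partial>lborel) = of_real (exp (- (norm y)\<^sup>2 / 2))"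
    using integral_lborel_prod[of ?f, OF int] by (simp only: eq char *)
qed

lemma integrable_gauss: "integrable lborel (gauss :: 'a::euclidean_space \<Rightarrow> real)"
  using integrable_gauss_exp[of "0::'a"] by (simp add: complex_of_real_integrable_eq)

lemma integral_gauss: "(\<integral>x. gauss (x::'a::euclidean_space) \<partial>lborel) = 1"
  using integral_gauss_exp[of "0::'a"] by simp

section \<open>Inversion and Plancherel\<close>

lemma Lp_norm_eq:
  assumes "(\<integral>\<^sup>+x. ennreal (cmod (f x) powr p) \<partial>lborel) = ennreal r" "r \<ge> 0"
  shows "Lp_norm p f = ennreal (r powr (1 / p))"
  using assms by (simp add: Lp_norm_def)

lemma Lp_norm_finite_iff:
  "Lp_norm p f < \<infinity> \<longleftrightarrow> (\<integral>\<^sup>+x. ennreal (cmod (f x) powr p) \<partial>lborel) < \<infinity>"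
  by (auto simp: Lp_norm_def Let_def less_top)

lemma Lp_norm_tendsto_0:
  assumes "(\<lambda>n. \<integral>\<^sup>+x. ennreal (cmod (f n x) powr p) \<partial>lborel) \<longlonglongrightarrow> 0" "p > 0"
  shows "(\<lambda>n. Lp_norm p (f n)) \<longlonglongrightarrow> 0"
proof -
  let ?I = "\<lambda>n. \<integral>\<^sup>+x. ennreal (cmod (f n x) powr p) \<partial>lborel"
  have "(\<lambda>n. enn2real (?I n)) \<longlonglongrightarrow> 0"
    using assms(1) by (intro tendsto_enn2real) auto
  then have "(\<lambda>n. enn2real (?I n) powr (1 / p)) \<longlonglongrightarrow> 0"
    using assms(2) by (intro tendsto_zero_powrI[where b="1 / p"]) auto
  then have lim: "(\<lambda>n. ennreal (enn2real (?I n) powr (1 / p))) \<longlonglongrightarrow> 0"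
    by (metis ennreal_0 tendsto_ennrealI)
  \<comment> \<open>\<open>enn2real\<close> sends infinity to 0, so eventual finiteness must be
    secured separately to land in the finite branch of \<open>Lp_norm\<close>.\<close>
  have "\<forall>\<^sub>F n in sequentially. ?I n < \<infinity>"
    using assms(1) by (rule order_tendstoD) simp
  then have "\<forall>\<^sub>F n in sequentially. ennreal (enn2real (?I n) powr (1 / p)) = Lp_norm p (f n)"
    by eventually_elim (simp add: Lp_norm_def less_top Let_def)
  with lim show ?thesis by (rule Lim_transform_eventually)
qed

section \<open>Gaussian summation of the inverse Fourier integral\<close>

definition inv_fourier :: "('a::euclidean_space \<Rightarrow> complex) \<Rightarrow> 'a \<Rightarrow> complex" where
  "inv_fourier G x = (\<integral>\<xi>. G \<xi> * exp (2 * of_real pi * \<i> * of_real (x \<bullet> \<xi>)) \<partial>lborel)"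

lemma inv_fourier_measurable [measurable]:
  assumes [measurable]: "G \<in> borel_measurable borel"
  shows "inv_fourier G \<in> borel_measurable borel"
  unfolding inv_fourier_def[abs_def] by measurable

lemma norm_inv_fourier_le:
  fixes G :: "'a::euclidean_space \<Rightarrow> complex"
  shows "cmod (inv_fourier G x) \<le> (\<integral>\<xi>. cmod (G \<xi>) \<partial>lborel)"
proof -
  have "cmod (inv_fourier G x) \<le>
      (\<integral>\<xi>. cmod (G \<xi> * exp (2 * of_real pi * \<i> * of_real (x \<bullet> \<xi>))) \<partial>lborel)"
    unfolding inv_fourier_def by (rule integral_norm_bound)
  then show ?thesis by (simp add: norm_mult)
qed

definition gauss_damp :: "real \<Rightarrow> 'a::euclidean_space \<Rightarrow> real" where
  "gauss_damp N x = exp (- (norm x / N)\<^sup>2 / 2)"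

lemma gauss_damp_eq:
  "gauss_damp N (x::'a::euclidean_space) = sqrt (2 * pi) ^ DIM('a) * gauss (x /\<^sub>R N)"
proof -
  have "(norm (x /\<^sub>R N))\<^sup>2 = (norm x / N)\<^sup>2"
    unfolding norm_scaleR abs_inverse divide_inverse power_mult_distrib
    by (simp add: power_inverse mult.commute)
  moreover have "sqrt (2 * pi) ^ DIM('a) * (1 / sqrt (2 * pi)) ^ DIM('a) = 1"
    unfolding power_mult_distrib[symmetric] by simp
  ultimately show ?thesis
    by (simp only: gauss_damp_def gauss_eq mult.assoc[symmetric] mult_1)
qed

lemma gauss_damp_bounds: "0 < gauss_damp N x" "gauss_damp N x \<le> 1"
  by (auto simp: gauss_damp_def)

lemma gauss_damp_measurable [measurable]: "gauss_damp N \<in> borel_measurable borel"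
  unfolding gauss_damp_def[abs_def] by measurable

lemma gauss_damp_tendsto: "(\<lambda>n. gauss_damp (real (Suc n)) x) \<longlonglongrightarrow> 1"
proof -
  have "(\<lambda>n. norm x / real (Suc n)) \<longlonglongrightarrow> 0"
    using LIMSEQ_Suc[OF lim_const_over_n[of "norm x"]] by simp
  from tendsto_exp[OF tendsto_divide[OF tendsto_minus[OF tendsto_power[OF this, of 2]] tendsto_const[of 2]]]
  show ?thesis by (simp add: gauss_damp_def)
qed

lemma integrable_gauss_damp:
  assumes "N > 0"
  shows "integrable lborel (gauss_damp N :: 'a::euclidean_space \<Rightarrow> real)"
proof -
  have "integrable lborel (\<lambda>x::'a. complex_of_real (gauss (0 + inverse N *\<^sub>R x)))"
    using assms integrable_gauss[where 'a='a]
    by (intro integrable_lborel_affine) (auto simp: complex_of_real_integrable_eq)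
  then have "integrable lborel (\<lambda>x::'a. gauss (inverse N *\<^sub>R x))"
    by (simp add: complex_of_real_integrable_eq)
  then show ?thesis by (simp add: gauss_damp_eq[abs_def])
qed

text \<open>Rescaling by N reduces this to the transform of the Gaussian. The result is written as a
  dilated probability density because it is the approximate identity that acts on the frequency
  side.\<close>

lemma fourier_gauss_damp:
  fixes y :: "'a::euclidean_space"
  assumes "N > 0"
  shows "(\<integral>x. of_real (gauss_damp N x) * exp (2 * of_real pi * \<i> * of_real (x \<bullet> y)) \<partial>lborel) =
    of_real ((2 * pi * N) ^ DIM('a) * gauss ((2 * pi * N) *\<^sub>R y))"
proof -
  let ?f = "\<lambda>x. of_real (gauss_damp N x) * exp (2 * of_real pi * \<i> * of_real (x \<bullet> y)) :: complex"
  have "?f (0 + N *\<^sub>R x) = of_real (sqrt (2 * pi) ^ DIM('a)) *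
      (of_real (gauss x) * exp (\<i> * of_real (x \<bullet> ((2 * pi * N) *\<^sub>R y))))" for x
    using assms by (simp add: gauss_damp_eq mult_ac)
  moreover have "(\<integral>x. ?f x \<partial>lborel) = \<bar>N\<bar> ^ DIM('a) *\<^sub>R (\<integral>x. ?f (0 + N *\<^sub>R x) \<partial>lborel)"
    using assms by (intro lborel_integral_affine) auto
  ultimately have "(\<integral>x. ?f x \<partial>lborel) = N ^ DIM('a) *\<^sub>R (of_real (sqrt (2 * pi) ^ DIM('a)) *
      of_real (exp (- (norm ((2 * pi * N) *\<^sub>R y))\<^sup>2 / 2)))"
    using assms by (simp only: integral_mult_right_zero integral_gauss_exp abs_of_pos)
  also have "\<dots> = of_real ((N * sqrt (2 * pi)) ^ DIM('a) * exp (- (norm ((2 * pi * N) *\<^sub>R y))\<^sup>2 / 2))"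
    by (simp add: scaleR_conv_of_real power_mult_distrib)
  \<comment> \<open>Splits off the normalizing constant of \<open>gauss\<close>, leaving the
    Jacobian of the dilation by 2 pi N.\<close>
  also have "N * sqrt (2 * pi) = (2 * pi * N) * (1 / sqrt (2 * pi))"
    by (simp add: field_simps)
  finally show ?thesis
    unfolding gauss_eq by (simp only: power_mult_distrib mult_ac)
qed

text \<open>Convolution with an approximate identity on the frequency side is damping by a Gaussian
  on the physical side; this is how inversion and Plancherel are obtained without decay of
  \<open>inv_fourier G\<close>.\<close>

definition gauss_conv :: "('a::euclidean_space \<Rightarrow> complex) \<Rightarrow> real \<Rightarrow> 'a \<Rightarrow> complex" where
  "gauss_conv G N \<zeta> = (\<integral>\<eta>. G (\<zeta> + inverse (2 * pi * N) *\<^sub>R \<eta>) * of_real (gauss \<eta>) \<partial>lborel)"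

lemma fourier_damped_inv_fourier:
  fixes G :: "'a::euclidean_space \<Rightarrow> complex"
  assumes int: "integrable lborel G" and N: "N > 0"
  shows "fourier_integral (\<lambda>x. inv_fourier G x * of_real (gauss_damp N x)) \<zeta> = gauss_conv G N \<zeta>"
proof -
  have [measurable]: "G \<in> borel_measurable borel" using int by auto
  let ?F = "\<lambda>x \<xi>. G \<xi> * exp (2 * of_real pi * \<i> * of_real (x \<bullet> \<xi>)) * (of_real (gauss_damp N x) *
      exp (- 2 * of_real pi * \<i> * of_real (x \<bullet> \<zeta>)))"
  have m [measurable]: "case_prod ?F \<in> borel_measurable (lborel \<Otimes>\<^sub>M lborel)"
    by (simp add: split_def)
  have nF: "norm (?F x \<xi>) = cmod (G \<xi>) * gauss_damp N x" for x \<xi>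
    using gauss_damp_bounds(1)[of N x] by (simp add: norm_mult)
  \<comment> \<open>The damping makes the double integral absolutely convergent: the modulus is the
    product of |G| and the Gaussian, each integrable in its own variable.\<close>
  have I: "integrable (lborel \<Otimes>\<^sub>M lborel) (case_prod ?F)"
  proof (rule lborel_pair.Fubini_integrable[OF m])
    show "integrable lborel (\<lambda>x. \<integral>y. norm (case (x, y) of (x, \<xi>) \<Rightarrow> ?F x \<xi>) \<partial>lborel)"
      unfolding prod.case nF using integrable_gauss_damp[where 'a='a, OF N] by simp
    show "AE x in lborel. integrable lborel (\<lambda>y. case (x, y) of (x, \<xi>) \<Rightarrow> ?F x \<xi>)"
    proof (rule AE_I2)
      fix x :: 'a
      have "integrable lborel (\<lambda>\<xi>. cmod (G \<xi>) * gauss_damp N x)" using int by simp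
      then show "integrable lborel (\<lambda>y. case (x, y) of (x, \<xi>) \<Rightarrow> ?F x \<xi>)"
        by (rule Bochner_Integration.integrable_bound) (use nF in auto)
    qed
  qed
  have "(\<integral>\<xi>. ?F x \<xi> \<partial>lborel) = inv_fourier G x * (of_real (gauss_damp N x) *
      exp (- 2 * of_real pi * \<i> * of_real (x \<bullet> \<zeta>)))" for x
    unfolding inv_fourier_def by (rule integral_mult_left_zero)
  then have "fourier_integral (\<lambda>x. inv_fourier G x * of_real (gauss_damp N x)) \<zeta> =
      (\<integral>x. (\<integral>\<xi>. ?F x \<xi> \<partial>lborel) \<partial>lborel)"
    by (simp only: fourier_integral_def mult.assoc)
  also have "\<dots> = (\<integral>\<xi>. (\<integral>x. ?F x \<xi> \<partial>lborel) \<partial>lborel)"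
    by (rule lborel_pair.Fubini_integral[OF I, symmetric])
  also have "\<dots> = (\<integral>\<xi>. G \<xi> * of_real ((2 * pi * N) ^ DIM('a) * gauss ((2 * pi * N) *\<^sub>R (\<xi> - \<zeta>))) \<partial>lborel)"
  proof (rule Bochner_Integration.integral_cong[OF refl])
    fix \<xi>
    have "?F x \<xi> = G \<xi> * (of_real (gauss_damp N x) * exp (2 * of_real pi * \<i> * of_real (x \<bullet> (\<xi> - \<zeta>))))" for x
      by (simp add: mult_ac exp_add[symmetric] inner_diff_right algebra_simps)
    then show "(\<integral>x. ?F x \<xi> \<partial>lborel) = G \<xi> * of_real ((2 * pi * N) ^ DIM('a) * gauss ((2 * pi * N) *\<^sub>R (\<xi> - \<zeta>)))"
      by (simp only: integral_mult_right_zero fourier_gauss_damp[OF N])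
  qed
  \<comment> \<open>Substitution of \<zeta> + \<eta>/(2 pi N) for \<xi>; its Jacobian cancels the
    height of the kernel.\<close>
  also have "\<dots> = \<bar>inverse (2 * pi * N)\<bar> ^ DIM('a) *\<^sub>R (\<integral>\<eta>. G (\<zeta> + inverse (2 * pi * N) *\<^sub>R \<eta>) *
      of_real ((2 * pi * N) ^ DIM('a) * gauss ((2 * pi * N) *\<^sub>R ((\<zeta> + inverse (2 * pi * N) *\<^sub>R \<eta>) - \<zeta>))) \<partial>lborel)"
    using N by (intro lborel_integral_affine) auto
  also have "\<dots> = \<bar>inverse (2 * pi * N)\<bar> ^ DIM('a) *\<^sub>R (of_real ((2 * pi * N) ^ DIM('a)) * gauss_conv G N \<zeta>)"
  proof -
    have "(2 * pi * N) * inverse (2 * pi * N) = 1" using N by (intro right_inverse) simp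
    then have "(2 * pi * N) *\<^sub>R ((\<zeta> + inverse (2 * pi * N) *\<^sub>R \<eta>) - \<zeta>) = \<eta>" for \<eta>
      by (simp only: add_diff_cancel_left' scaleR_scaleR scaleR_one)
    then have "G (\<zeta> + inverse (2 * pi * N) *\<^sub>R \<eta>) * of_real ((2 * pi * N) ^ DIM('a) *
        gauss ((2 * pi * N) *\<^sub>R ((\<zeta> + inverse (2 * pi * N) *\<^sub>R \<eta>) - \<zeta>))) =
      of_real ((2 * pi * N) ^ DIM('a)) * (G (\<zeta> + inverse (2 * pi * N) *\<^sub>R \<eta>) * of_real (gauss \<eta>))" for \<eta>
      by (simp only: of_real_mult mult_ac)
    then show ?thesis
      by (simp only: gauss_conv_def integral_mult_right_zero)
  qed
  also have "\<dots> = gauss_conv G N \<zeta>"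
  proof -
    have "\<bar>inverse c\<bar> * c = 1" if "c > 0" for c :: real using that by simp
    then have "\<bar>inverse (2 * pi * N)\<bar> ^ DIM('a) * (2 * pi * N) ^ DIM('a) = 1"
      using N by (metis mult_pos_pos pi_gt_zero power_mult_distrib power_one zero_less_numeral)
    then show ?thesis
      by (simp only: scaleR_conv_of_real mult.assoc[symmetric] of_real_mult[symmetric] of_real_1 mult_1)
  qed
  finally show ?thesis .
qed

lemma gauss_conv_measurable [measurable]:
  assumes [measurable]: "G \<in> borel_measurable borel"
  shows "gauss_conv G N \<in> borel_measurable borel"
  unfolding gauss_conv_def[abs_def] by measurable

lemma norm_gauss_conv_le:
  fixes G :: "'a::euclidean_space \<Rightarrow> complex"
  assumes [measurable]: "G \<in> borel_measurable borel" and bd: "\<And>x. cmod (G x) \<le> K"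
  shows "cmod (gauss_conv G N \<zeta>) \<le> K"
proof -
  have le: "norm (G (\<zeta> + inverse (2 * pi * N) *\<^sub>R \<eta>) * of_real (gauss \<eta>)) \<le> K * gauss \<eta>" for \<eta>
    by (auto simp: norm_mult abs_of_nonneg[OF gauss_nonneg] intro!: mult_right_mono bd gauss_nonneg)
  have int: "integrable lborel (\<lambda>\<eta>::'a. K * gauss \<eta>)" using integrable_gauss[where 'a='a] by simp
  have "cmod (gauss_conv G N \<zeta>) \<le> (\<integral>\<eta>. K * gauss (\<eta>::'a) \<partial>lborel)"
    unfolding gauss_conv_def
  proof (rule Bochner_Integration.integral_norm_bound_integral[OF _ int])
    show "integrable lborel (\<lambda>\<eta>. G (\<zeta> + inverse (2 * pi * N) *\<^sub>R \<eta>) * of_real (gauss \<eta>))"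
      by (rule Bochner_Integration.integrable_bound[OF int])
         (use order.trans[OF le abs_ge_self] in auto)
  qed (rule le)
  then show ?thesis by (simp add: integral_gauss)
qed

text \<open>In \<open>gauss_conv\<close> the parameter N occurs only in the argument of G, so a
  fixed multiple of \<open>gauss\<close> dominates all the integrands, and continuity of G gives
  their pointwise limit.\<close>

lemma gauss_conv_tendsto:
  fixes G :: "'a::euclidean_space \<Rightarrow> complex"
  assumes cont: "continuous_on UNIV G" and bd: "\<And>x. cmod (G x) \<le> K"
  shows "(\<lambda>n. gauss_conv G (real (Suc n)) \<zeta>) \<longlonglongrightarrow> G \<zeta>"
proof -
  have [measurable]: "G \<in> borel_measurable borel"
    using cont by (simp add: borel_measurable_continuous_onI)
  have "(\<lambda>n. \<integral>\<eta>. G (\<zeta> + inverse (2 * pi * real (Suc n)) *\<^sub>R \<eta>) * of_real (gauss \<eta>) \<partial>lborel)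
      \<longlonglongrightarrow> (\<integral>\<eta>. G \<zeta> * of_real (gauss (\<eta>::'a)) \<partial>lborel)"
  proof (rule integral_dominated_convergence)
    show "integrable lborel (\<lambda>\<eta>::'a. K * gauss \<eta>)" using integrable_gauss[where 'a='a] by simp
    show "AE \<eta> in lborel. (\<lambda>n. G (\<zeta> + inverse (2 * pi * real (Suc n)) *\<^sub>R \<eta>) * of_real (gauss \<eta>))
        \<longlonglongrightarrow> G \<zeta> * of_real (gauss \<eta>)"
    proof (rule AE_I2)
      fix \<eta> :: 'a
      have "(\<lambda>n. inverse (2 * pi) * inverse (real (Suc n))) \<longlonglongrightarrow> inverse (2 * pi) * 0"
        by (intro tendsto_intros LIMSEQ_inverse_real_of_nat)
      then have "(\<lambda>n. inverse (2 * pi * real (Suc n))) \<longlonglongrightarrow> 0" by (simp add: inverse_mult_distrib)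
      then have "(\<lambda>n. \<zeta> + inverse (2 * pi * real (Suc n)) *\<^sub>R \<eta>) \<longlonglongrightarrow> \<zeta> + 0 *\<^sub>R \<eta>"
        by (intro tendsto_intros)
      then have "(\<lambda>n. \<zeta> + inverse (2 * pi * real (Suc n)) *\<^sub>R \<eta>) \<longlonglongrightarrow> \<zeta>" by simp
      then have "(\<lambda>n. G (\<zeta> + inverse (2 * pi * real (Suc n)) *\<^sub>R \<eta>)) \<longlonglongrightarrow> G \<zeta>"
        using cont by (rule_tac continuous_on_tendsto_compose[of UNIV G]) auto
      then show "(\<lambda>n. G (\<zeta> + inverse (2 * pi * real (Suc n)) *\<^sub>R \<eta>) * of_real (gauss \<eta>))
        \<longlonglongrightarrow> G \<zeta> * of_real (gauss \<eta>)" by (intro tendsto_intros)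
    qed
    show "AE \<eta> in lborel. norm (G (\<zeta> + inverse (2 * pi * real (Suc n)) *\<^sub>R \<eta>) * of_real (gauss \<eta>))
        \<le> K * gauss \<eta>" for n
      by (auto simp: norm_mult abs_of_nonneg[OF gauss_nonneg] intro!: mult_right_mono bd gauss_nonneg)
  qed auto
  moreover have "(\<integral>\<eta>. G \<zeta> * of_real (gauss (\<eta>::'a)) \<partial>lborel) = G \<zeta>"
    by (simp add: integral_gauss)
  ultimately show ?thesis by (simp only: gauss_conv_def)
qed

text \<open>Convolution with a probability density contracts L1: Tonelli, then translation
  invariance for each fixed \<eta>.\<close>

lemma nn_integral_gauss_conv_le:
  fixes G :: "'a::euclidean_space \<Rightarrow> complex"
  assumes [measurable]: "G \<in> borel_measurable borel"
  shows "(\<integral>\<^sup>+\<zeta>. cmod (gauss_conv G N \<zeta>) \<partial>lborel) \<le> (\<integral>\<^sup>+\<zeta>. cmod (G \<zeta>) \<partial>lborel)"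
proof -
  let ?c = "inverse (2 * pi * N)"
  have "(\<integral>\<^sup>+\<zeta>. cmod (gauss_conv G N \<zeta>) \<partial>lborel) \<le>
      (\<integral>\<^sup>+\<zeta>. (\<integral>\<^sup>+\<eta>. ennreal (cmod (G (\<zeta> + ?c *\<^sub>R \<eta>))) * ennreal (gauss \<eta>) \<partial>lborel) \<partial>lborel)"
  proof (rule nn_integral_mono)
    fix \<zeta> :: 'a
    have "ennreal (cmod (gauss_conv G N \<zeta>)) \<le>
        (\<integral>\<^sup>+\<eta>. ennreal (norm (G (\<zeta> + ?c *\<^sub>R \<eta>) * of_real (gauss \<eta>))) \<partial>lborel)"
      unfolding gauss_conv_def
      \<comment> \<open>Where the integrand is not integrable, the Bochner integral is 0 by default
        and the bound is trivial.\<close>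
      by (cases "integrable lborel (\<lambda>\<eta>. G (\<zeta> + ?c *\<^sub>R \<eta>) * of_real (gauss \<eta>))")
         (auto simp: integral_norm_bound_ennreal not_integrable_integral_eq)
    then show "ennreal (cmod (gauss_conv G N \<zeta>)) \<le>
        (\<integral>\<^sup>+\<eta>. ennreal (cmod (G (\<zeta> + ?c *\<^sub>R \<eta>))) * ennreal (gauss \<eta>) \<partial>lborel)"
      by (simp add: norm_mult abs_of_nonneg[OF gauss_nonneg] ennreal_mult gauss_nonneg)
  qed
  also have "\<dots> = (\<integral>\<^sup>+\<eta>. (\<integral>\<^sup>+\<zeta>. ennreal (cmod (G (\<zeta> + ?c *\<^sub>R \<eta>))) * ennreal (gauss \<eta>) \<partial>lborel) \<partial>lborel)"
    by (rule lborel_pair.Fubini') simp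
  also have "\<dots> = (\<integral>\<^sup>+\<eta>. (\<integral>\<^sup>+\<zeta>. ennreal (cmod (G \<zeta>)) \<partial>lborel) * ennreal (gauss (\<eta>::'a)) \<partial>lborel)"
  proof (rule nn_integral_cong)
    fix \<eta> :: 'a
    have "(\<integral>\<^sup>+\<zeta>. ennreal (cmod (G \<zeta>)) \<partial>lborel) = (\<integral>\<^sup>+\<zeta>. ennreal (cmod (G (\<zeta> + ?c *\<^sub>R \<eta>))) \<partial>lborel)"
      using nn_integral_lborel_affine[of 1 "\<lambda>\<zeta>. ennreal (cmod (G \<zeta>))" "?c *\<^sub>R \<eta>"] by (simp add: add.commute)
    then show "(\<integral>\<^sup>+\<zeta>. ennreal (cmod (G (\<zeta> + ?c *\<^sub>R \<eta>))) * ennreal (gauss \<eta>) \<partial>lborel) =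
        (\<integral>\<^sup>+\<zeta>. ennreal (cmod (G \<zeta>)) \<partial>lborel) * ennreal (gauss \<eta>)"
      by (simp add: nn_integral_multc)
  qed
  also have "\<dots> = (\<integral>\<^sup>+\<zeta>. ennreal (cmod (G \<zeta>)) \<partial>lborel)"
    using nn_integral_eq_integral[OF integrable_gauss[where 'a='a]]
    by (subst nn_integral_cmult) (auto simp: gauss_nonneg integral_gauss)
  finally show ?thesis .
qed

text \<open>Pointwise convergence and nonincreasing L1 norms give L1 convergence by Scheffe. Both
  functions are bounded by K, so the squared difference is at most 2K times the difference, which
  upgrades this to L2.\<close>

lemma gauss_conv_tendsto_L2:
  fixes G :: "'a::euclidean_space \<Rightarrow> complex"
  assumes cont: "continuous_on UNIV G" and int: "integrable lborel G" and bd: "\<And>x. cmod (G x) \<le> K"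
  shows "(\<lambda>n. Lp_norm 2 (\<lambda>\<zeta>. gauss_conv G (real (Suc n)) \<zeta> - G \<zeta>)) \<longlonglongrightarrow> 0"
proof (rule Lp_norm_tendsto_0)
  have [measurable]: "G \<in> borel_measurable borel" using int by auto
  have K: "K \<ge> 0" using order.trans[OF norm_ge_zero bd] .
  let ?D = "\<lambda>n \<zeta>. gauss_conv G (real (Suc n)) \<zeta> - G \<zeta>"
  have "(\<lambda>n. \<integral>\<^sup>+\<zeta>. norm (?D n \<zeta>) \<partial>lborel) \<longlonglongrightarrow> 0"
    by (rule Scheffe_lemma2)
       (use int gauss_conv_tendsto[OF cont bd] nn_integral_gauss_conv_le[of G] in auto)
  then have "(\<lambda>n. ennreal (2 * K) * (\<integral>\<^sup>+\<zeta>. norm (?D n \<zeta>) \<partial>lborel)) \<longlonglongrightarrow> ennreal (2 * K) * 0"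
    by (intro ennreal_tendsto_cmult) auto
  then have lim: "(\<lambda>n. ennreal (2 * K) * (\<integral>\<^sup>+\<zeta>. norm (?D n \<zeta>) \<partial>lborel)) \<longlonglongrightarrow> 0" by simp
  have le: "(\<integral>\<^sup>+\<zeta>. ennreal (cmod (?D n \<zeta>) powr 2) \<partial>lborel) \<le> ennreal (2 * K) * (\<integral>\<^sup>+\<zeta>. norm (?D n \<zeta>) \<partial>lborel)" for n
  proof -
    have "cmod (?D n \<zeta>) powr 2 \<le> 2 * K * cmod (?D n \<zeta>)" for \<zeta>
    proof -
      have "cmod (?D n \<zeta>) \<le> cmod (gauss_conv G (real (Suc n)) \<zeta>) + cmod (G \<zeta>)"
        by (rule norm_triangle_ineq4)
      also have "\<dots> \<le> 2 * K"
        using add_mono[OF norm_gauss_conv_le[where G=G, OF _ bd] bd[of \<zeta>]] by simp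
      finally show ?thesis by (simp add: power2_eq_square mult_right_mono)
    qed
    then have "(\<integral>\<^sup>+\<zeta>. ennreal (cmod (?D n \<zeta>) powr 2) \<partial>lborel) \<le> (\<integral>\<^sup>+\<zeta>. ennreal (2 * K) * ennreal (cmod (?D n \<zeta>)) \<partial>lborel)"
      using K by (intro nn_integral_mono) (simp flip: ennreal_mult)
    then show ?thesis by (simp add: nn_integral_cmult)
  qed
  show "(\<lambda>n. \<integral>\<^sup>+\<zeta>. ennreal (cmod (?D n \<zeta>) powr 2) \<partial>lborel) \<longlonglongrightarrow> 0"
    by (rule tendsto_sandwich[OF _ _ tendsto_const lim]) (use le in auto)
qed simp

section \<open>Plancherel's identity and membership in \<open>fourier_L2\<close>\<close>

lemma cnj_measurable [measurable]: "cnj \<in> borel_measurable borel"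
  by (intro borel_measurable_continuous_onI continuous_intros)

text \<open>Parseval with a damping factor: writing the conjugate factor as an integral and
  exchanging the order moves the Fourier integral onto the damped function, whose transform is
  \<open>gauss_conv\<close>.\<close>

lemma integral_damped_inv_fourier_cnj:
  fixes G :: "'a::euclidean_space \<Rightarrow> complex"
  assumes int: "integrable lborel G" and N: "N > 0"
  shows "(\<integral>x. inv_fourier G x * of_real (gauss_damp N x) * cnj (inv_fourier G x) \<partial>lborel) =
    (\<integral>\<zeta>. gauss_conv G N \<zeta> * cnj (G \<zeta>) \<partial>lborel)"
proof -
  have [measurable]: "G \<in> borel_measurable borel" using int by auto
  define L where "L = (\<integral>\<xi>. cmod (G \<xi>) \<partial>lborel)"
  let ?h = "\<lambda>x. inv_fourier G x * of_real (gauss_damp N x)"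
  have hint: "integrable lborel (\<lambda>x. L * gauss_damp N (x::'a))" using integrable_gauss_damp[where 'a='a, OF N] by simp
  have hle: "norm (?h x) \<le> L * gauss_damp N x" for x
    using gauss_damp_bounds(1)[of N x] norm_inv_fourier_le[of G x]
    by (auto simp: norm_mult L_def intro!: mult_right_mono)
  have h: "integrable lborel ?h"
    by (rule Bochner_Integration.integrable_bound[OF hint])
       (use order.trans[OF hle abs_ge_self] in auto)
  let ?F = "\<lambda>x \<zeta>. ?h x * exp (- 2 * of_real pi * \<i> * of_real (x \<bullet> \<zeta>)) * cnj (G \<zeta>)"
  have m [measurable]: "case_prod ?F \<in> borel_measurable (lborel \<Otimes>\<^sub>M lborel)"
    unfolding split_def by measurable
  have nF: "norm (?F x \<zeta>) = norm (?h x) * cmod (G \<zeta>)" for x \<zeta>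
    by (simp add: norm_mult)
  have I: "integrable (lborel \<Otimes>\<^sub>M lborel) (case_prod ?F)"
  proof (rule lborel_pair.Fubini_integrable[OF m])
    show "integrable lborel (\<lambda>x. \<integral>y. norm (case (x, y) of (x, \<xi>) \<Rightarrow> ?F x \<xi>) \<partial>lborel)"
      unfolding prod.case nF using h by simp
    show "AE x in lborel. integrable lborel (\<lambda>y. case (x, y) of (x, \<xi>) \<Rightarrow> ?F x \<xi>)"
    proof (rule AE_I2)
      fix x :: 'a
      have "integrable lborel (\<lambda>\<xi>. norm (?h x) * cmod (G \<xi>))" using int by simp
      then show "integrable lborel (\<lambda>y. case (x, y) of (x, \<xi>) \<Rightarrow> ?F x \<xi>)"
        by (rule Bochner_Integration.integrable_bound) (use nF in auto)
    qed
  qed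
  have "cnj (inv_fourier G x) = (\<integral>\<zeta>. exp (- 2 * of_real pi * \<i> * of_real (x \<bullet> \<zeta>)) * cnj (G \<zeta>) \<partial>lborel)" for x
    unfolding inv_fourier_def
    by (subst Bochner_Integration.integral_cnj[symmetric])
       (simp_all add: exp_cnj mult_ac)
  then have "?h x * cnj (inv_fourier G x) = (\<integral>\<zeta>. ?F x \<zeta> \<partial>lborel)" for x
    by (simp add: mult.assoc)
  then have "(\<integral>x. ?h x * cnj (inv_fourier G x) \<partial>lborel) = (\<integral>x. (\<integral>\<zeta>. ?F x \<zeta> \<partial>lborel) \<partial>lborel)"
    by simp
  also have "\<dots> = (\<integral>\<zeta>. (\<integral>x. ?F x \<zeta> \<partial>lborel) \<partial>lborel)"
    by (rule lborel_pair.Fubini_integral[OF I, symmetric])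
  also have "\<dots> = (\<integral>\<zeta>. fourier_integral ?h \<zeta> * cnj (G \<zeta>) \<partial>lborel)"
    by (simp add: fourier_integral_def)
  finally show ?thesis
    unfolding fourier_damped_inv_fourier[OF int N] .
qed

text \<open>Let N grow in the damped identity. On the physical side the damping increases to 1, so
  monotone convergence applies without knowing square integrability in advance; on the frequency
  side K times |G| dominates.\<close>

proposition Plancherel_inv_fourier:
  fixes G :: "'a::euclidean_space \<Rightarrow> complex"
  assumes cont: "continuous_on UNIV G" and int: "integrable lborel G" and bd: "\<And>x. cmod (G x) \<le> K"
  shows "(\<integral>\<^sup>+x. ennreal ((cmod (inv_fourier G x))\<^sup>2) \<partial>lborel) = ennreal (\<integral>\<zeta>. (cmod (G \<zeta>))\<^sup>2 \<partial>lborel)"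
proof -
  have [measurable]: "G \<in> borel_measurable borel" using int by auto
  define L where "L = (\<integral>\<xi>. cmod (G \<xi>) \<partial>lborel)"
  let ?g = "inv_fourier G"
  let ?E = "\<lambda>n. gauss_damp (real (Suc n)) :: 'a \<Rightarrow> real"
  let ?f = "\<lambda>n x. (cmod (?g x))\<^sup>2 * ?E n x"
  have fint: "integrable lborel (?f n)" for n
  proof (rule Bochner_Integration.integrable_bound)
    show "integrable lborel (\<lambda>x. L\<^sup>2 * ?E n x)" using integrable_gauss_damp[where 'a='a, of "real (Suc n)"] by simp
    have "?f n x \<le> L\<^sup>2 * ?E n x" for x
      using gauss_damp_bounds(1)[of "real (Suc n)" x] norm_inv_fourier_le[of G x]
      by (intro mult_right_mono power_mono) (auto simp: L_def)
    moreover have "?f n x \<ge> 0" for x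
      using gauss_damp_bounds(1)[of "real (Suc n)" x] by simp
    ultimately show "AE x in lborel. norm (?f n x) \<le> norm (L\<^sup>2 * ?E n x)"
      unfolding real_norm_def by (intro AE_I2) (metis abs_ge_self abs_of_nonneg order.trans)
  qed simp
  have f: "of_real (integral\<^sup>L lborel (?f n)) = (\<integral>\<zeta>. gauss_conv G (real (Suc n)) \<zeta> * cnj (G \<zeta>) \<partial>lborel)" for n
  proof -
    have "complex_of_real (?f n x) = ?g x * of_real (?E n x) * cnj (?g x)" for x
      by (simp only: of_real_mult complex_norm_square mult_ac)
    then show ?thesis
      using integral_damped_inv_fourier_cnj[OF int, of "real (Suc n)"]
      by (simp only: integral_complex_of_real[symmetric] of_nat_0_less_iff zero_less_Suc simp_thms)
  qed
  have "(\<lambda>n. \<integral>\<zeta>. gauss_conv G (real (Suc n)) \<zeta> * cnj (G \<zeta>) \<partial>lborel) \<longlonglongrightarrow> (\<integral>\<zeta>. G \<zeta> * cnj (G \<zeta>) \<partial>lborel)"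
  proof (rule integral_dominated_convergence)
    show "integrable lborel (\<lambda>\<zeta>. K * cmod (G \<zeta>))" using int by simp
    show "AE \<zeta> in lborel. (\<lambda>n. gauss_conv G (real (Suc n)) \<zeta> * cnj (G \<zeta>)) \<longlonglongrightarrow> G \<zeta> * cnj (G \<zeta>)"
      by (intro AE_I2 tendsto_intros gauss_conv_tendsto[OF cont bd])
    show "AE \<zeta> in lborel. norm (gauss_conv G (real (Suc n)) \<zeta> * cnj (G \<zeta>)) \<le> K * cmod (G \<zeta>)" for n
      by (intro AE_I2) (auto simp: norm_mult intro!: mult_right_mono norm_gauss_conv_le bd)
  qed auto
  moreover have "(\<integral>\<zeta>. G \<zeta> * cnj (G \<zeta>) \<partial>lborel) = of_real (\<integral>\<zeta>. (cmod (G \<zeta>))\<^sup>2 \<partial>lborel)"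
    unfolding integral_complex_of_real[symmetric] complex_norm_square ..
  ultimately have "(\<lambda>n. complex_of_real (integral\<^sup>L lborel (?f n))) \<longlonglongrightarrow> of_real (\<integral>\<zeta>. (cmod (G \<zeta>))\<^sup>2 \<partial>lborel)"
    by (simp only: f)
  then have "(\<lambda>n. integral\<^sup>L lborel (?f n)) \<longlonglongrightarrow> (\<integral>\<zeta>. (cmod (G \<zeta>))\<^sup>2 \<partial>lborel)"
    by (simp only: tendsto_of_real_iff)
  then have "(\<lambda>n. ennreal (integral\<^sup>L lborel (?f n))) \<longlonglongrightarrow> ennreal (\<integral>\<zeta>. (cmod (G \<zeta>))\<^sup>2 \<partial>lborel)"
    by (rule tendsto_ennrealI)
  moreover have "ennreal (integral\<^sup>L lborel (?f n)) = (\<integral>\<^sup>+x. ennreal (?f n x) \<partial>lborel)" for n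
    by (rule nn_integral_eq_integral[OF fint, symmetric])
       (intro AE_I2 mult_nonneg_nonneg less_imp_le[OF gauss_damp_bounds(1)], simp)
  moreover have "(\<lambda>n. \<integral>\<^sup>+x. ennreal (?f n x) \<partial>lborel) \<longlonglongrightarrow> (\<integral>\<^sup>+x. ennreal ((cmod (?g x))\<^sup>2) \<partial>lborel)"
  proof (rule nn_integral_LIMSEQ)
    show "incseq (\<lambda>n x. ennreal (?f n x))"
    proof (rule incseq_SucI, rule le_funI)
      fix n and x :: 'a
      have "norm x / real (Suc (Suc n)) \<le> norm x / real (Suc n)"
        by (intro divide_left_mono) auto
      then have "?E n x \<le> ?E (Suc n) x"
        unfolding gauss_damp_def by (auto intro!: divide_right_mono power_mono simp del: of_nat_Suc)
      then show "ennreal (?f n x) \<le> ennreal (?f (Suc n) x)"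
        by (intro ennreal_leI mult_left_mono) auto
    qed
    show "(\<lambda>n. ennreal (?f n x)) \<longlonglongrightarrow> ennreal ((cmod (?g x))\<^sup>2)" for x
      using tendsto_ennrealI[OF tendsto_mult[OF tendsto_const gauss_damp_tendsto], of "(cmod (?g x))\<^sup>2" x] by simp
  qed simp
  ultimately show ?thesis
    by (simp only: LIMSEQ_unique)
qed

lemma Lp_space_2I:
  assumes "f \<in> borel_measurable borel" "(\<integral>\<^sup>+x. ennreal ((cmod (f x))\<^sup>2) \<partial>lborel) < \<infinity>"
  shows "f \<in> Lp_space 2"
  using assms unfolding Lp_space_def Lp_norm_finite_iff by simp

lemma square_integrable_bounded:
  assumes int: "integrable lborel G" and bd: "\<And>x. cmod (G x) \<le> K"
  shows "integrable lborel (\<lambda>x. (cmod (G x))\<^sup>2)"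
proof (rule Bochner_Integration.integrable_bound)
  show "integrable lborel (\<lambda>x. K * cmod (G x))" using int by simp
  have [measurable]: "G \<in> borel_measurable borel" using int by auto
  show "(\<lambda>x. (cmod (G x))\<^sup>2) \<in> borel_measurable lborel" by simp
  have "(cmod (G x))\<^sup>2 \<le> K * cmod (G x)" for x
    unfolding power2_eq_square by (rule mult_right_mono[OF bd]) simp
  then show "AE x in lborel. norm ((cmod (G x))\<^sup>2) \<le> norm (K * cmod (G x))"
    by (intro AE_I2) (metis abs_ge_self norm_power order.trans real_norm_def abs_norm_cancel)
qed

text \<open>The approximants that \<open>fourier_L2\<close> demands are the Gaussian dampings of the
  inverse transform: a bounded function times a Gaussian is in L1, they converge in L2 by
  domination, and their transforms \<open>gauss_conv\<close> converge to G in L2.\<close>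

proposition fourier_L2_inv_fourier:
  fixes G :: "'a::euclidean_space \<Rightarrow> complex"
  assumes cont: "continuous_on UNIV G" and int: "integrable lborel G" and bd: "\<And>x. cmod (G x) \<le> K"
  shows "fourier_L2 (inv_fourier G) G"
proof -
  have [measurable]: "G \<in> borel_measurable borel" using int by auto
  let ?g = "inv_fourier G"
  let ?E = "\<lambda>n. gauss_damp (real (Suc n)) :: 'a \<Rightarrow> real"
  let ?h = "\<lambda>n x. ?g x * of_real (?E n x)"
  have gfin: "(\<integral>\<^sup>+x. ennreal ((cmod (?g x))\<^sup>2) \<partial>lborel) < \<infinity>"
    using Plancherel_inv_fourier[OF cont int bd] by simp
  have hg: "cmod (?h n x) \<le> cmod (?g x)" for n x
    using gauss_damp_bounds[of "real (Suc n)" x] by (simp add: norm_mult mult_left_le)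
  have g: "?g \<in> Lp_space 2" by (intro Lp_space_2I gfin) simp
  have G: "G \<in> Lp_space 2"
    using square_integrable_bounded[OF int bd]
    by (intro Lp_space_2I) (auto simp: integrable_iff_bounded)
  have h2: "?h n \<in> Lp_space 2" for n
  proof (rule Lp_space_2I)
    have "(\<integral>\<^sup>+x. ennreal ((cmod (?h n x))\<^sup>2) \<partial>lborel) \<le> (\<integral>\<^sup>+x. ennreal ((cmod (?g x))\<^sup>2) \<partial>lborel)"
      by (intro nn_integral_mono ennreal_leI power_mono hg) auto
    with gfin show "(\<integral>\<^sup>+x. ennreal ((cmod (?h n x))\<^sup>2) \<partial>lborel) < \<infinity>" by (rule le_less_trans[rotated])
  qed simp
  have h1: "?h n \<in> Lp_space 1" for n
  proof -
    define L where "L = (\<integral>\<xi>. cmod (G \<xi>) \<partial>lborel)"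
    have "cmod (?h n x) \<le> L * ?E n x" for x
      using gauss_damp_bounds(1)[of "real (Suc n)" x] norm_inv_fourier_le[of G x]
      by (auto simp: norm_mult L_def intro!: mult_right_mono)
    then have "(\<integral>\<^sup>+x. ennreal (cmod (?h n x)) \<partial>lborel) \<le> (\<integral>\<^sup>+x. ennreal (norm (L * ?E n x)) \<partial>lborel)"
      by (intro nn_integral_mono ennreal_leI) (metis abs_ge_self order.trans real_norm_def)
    also have "\<dots> < \<infinity>"
      using integrable_mult_right[OF integrable_gauss_damp[of "real (Suc n)", where 'a='a], of L]
      unfolding integrable_iff_bounded by simp
    finally show ?thesis
      unfolding Lp_space_def Lp_norm_finite_iff by simp
  qed
  have "(\<lambda>n. \<integral>\<^sup>+x. ennreal (cmod (?h n x - ?g x) powr 2) \<partial>lborel) \<longlonglongrightarrow> (\<integral>\<^sup>+x. 0 \<partial>(lborel :: 'a measure))"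
  proof (rule nn_integral_dominated_convergence)
    show "(\<integral>\<^sup>+x. ennreal ((cmod (?g x))\<^sup>2) \<partial>lborel) < \<infinity>" by (rule gfin)
    have "cmod (?h n x - ?g x) \<le> cmod (?g x)" for n x
    proof -
      have "?h n x - ?g x = ?g x * of_real (?E n x - 1)" by (simp add: algebra_simps)
      then show ?thesis
        using gauss_damp_bounds[of "real (Suc n)" x]
        by (simp only: norm_mult norm_of_real) (simp add: mult_left_le)
    qed
    then show "AE x in lborel. ennreal (cmod (?h n x - ?g x) powr 2) \<le> ennreal ((cmod (?g x))\<^sup>2)" for n
      by (intro AE_I2 ennreal_leI) (auto intro!: power_mono)
    have "(\<lambda>n. ennreal (cmod (?h n x - ?g x) ^ 2)) \<longlonglongrightarrow> ennreal (cmod (?g x * of_real 1 - ?g x) ^ 2)" for x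
      by (intro tendsto_ennrealI tendsto_intros gauss_damp_tendsto)
    then show "AE x in lborel. (\<lambda>n. ennreal (cmod (?h n x - ?g x) powr 2)) \<longlonglongrightarrow> 0"
      by (intro AE_I2) simp
  qed auto
  then have "(\<lambda>n. Lp_norm 2 (\<lambda>x. ?h n x - ?g x)) \<longlonglongrightarrow> 0"
    by (intro Lp_norm_tendsto_0) auto
  moreover have "(\<lambda>n. Lp_norm 2 (\<lambda>\<xi>. fourier_integral (?h n) \<xi> - G \<xi>)) \<longlonglongrightarrow> 0"
    using gauss_conv_tendsto_L2[OF cont int bd]
    by (simp add: fourier_damped_inv_fourier[OF int])
  ultimately show ?thesis
    unfolding fourier_L2_def using g G h1 h2 by (intro conjI exI[of _ ?h]) auto
qed

section \<open>One-dimensional oscillatory integrals\<close>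

definition quad_exp :: "real \<Rightarrow> real \<Rightarrow> real \<Rightarrow> complex" where
  "quad_exp \<mu> y s = exp (\<i> * of_real (\<mu> * s\<^sup>2 + y * s))"

lemma norm_quad_exp [simp]: "cmod (quad_exp \<mu> y s) = 1"
  by (simp add: quad_exp_def)

lemma continuous_on_quad_exp [continuous_intros]: "continuous_on S (quad_exp \<mu> y)"
  unfolding quad_exp_def[abs_def] by (intro continuous_intros)

lemma quad_exp_integrable: "quad_exp \<mu> y integrable_on {a..b}"
  by (intro integrable_continuous_interval continuous_intros)

text \<open>Integration by parts away from the critical point c: the phase has derivative 2\<mu>(s -
  c), and dividing by it leaves two boundary terms and the integral of 1/(s - c)^2, which telescopes
  to 1/(a - c) - 1/(b - c).\<close>

lemma quad_exp_integral_off_critical: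
  fixes \<mu> y a b :: real
  assumes \<mu>: "\<mu> \<noteq> 0" and "a \<le> b" and c: "c = - y / (2 * \<mu>)" and off: "c < a \<or> b < c"
  shows "cmod (integral {a..b} (quad_exp \<mu> y)) \<le>
    (1 / \<bar>a - c\<bar> + 1 / \<bar>b - c\<bar> + (1 / (a - c) - 1 / (b - c))) / (2 * \<bar>\<mu>\<bar>)"
proof -
  have nz: "u - c \<noteq> 0" if "u \<in> {a..b}" for u using off that by auto
  have y: "y = - (2 * \<mu> * c)" using \<mu> c by simp
  define K where "K = 2 * \<i> * complex_of_real \<mu>"
  have K: "K \<noteq> 0" "cmod K = 2 * \<bar>\<mu>\<bar>" using \<mu> by (auto simp: K_def norm_mult)
  \<comment> \<open>W is the reciprocal of the logarithmic derivative K(u - c) of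
    \<open>quad_exp\<close>; R is the error when \<open>quad_exp\<close> times W is taken as its
    antiderivative.\<close>
  define W where "W = (\<lambda>z. inverse (K * (z - of_real c)))"
  define R where "R u = quad_exp \<mu> y u / (K * (of_real u - of_real c)\<^sup>2)" for u :: real
  have "((\<lambda>u. quad_exp \<mu> y u - R u) has_integral
      (quad_exp \<mu> y b * W (of_real b) - quad_exp \<mu> y a * W (of_real a))) {a..b}"
  proof (rule fundamental_theorem_of_calculus[OF \<open>a \<le> b\<close>])
    fix u assume "u \<in> {a..b}"
    from nz[OF this] have u: "complex_of_real u - of_real c \<noteq> 0" by (simp flip: of_real_diff)
    let ?E = "\<lambda>z. exp (\<i> * (of_real \<mu> * z\<^sup>2 + of_real y * z))"
    have E: "(?E has_field_derivative ?E (of_real u) * (K * (of_real u - of_real c))) (at (of_real u))"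
    proof (rule DERIV_cong)
      show "(?E has_field_derivative ?E (of_real u) *
          (\<i> * (of_real \<mu> * (2 * of_real u) + of_real y))) (at (of_real u))"
        by (auto intro!: derivative_eq_intros)
      have "of_real y = - (2 * complex_of_real \<mu> * of_real c)" by (subst y) simp
      then have "\<i> * (of_real \<mu> * (2 * of_real u) + of_real y) = K * (of_real u - of_real c)"
        by (simp only: K_def) (simp add: algebra_simps)
      then show "?E (of_real u) * (\<i> * (of_real \<mu> * (2 * of_real u) + of_real y)) =
          ?E (of_real u) * (K * (of_real u - of_real c))"
        by (simp only:)
    qed
    have "(W has_field_derivative - (W (of_real u) * K * W (of_real u))) (at (of_real u))"
      unfolding W_def using u K by (auto intro!: derivative_eq_intros)
    from DERIV_mult[OF E this]
    have "((\<lambda>z. ?E z * W z) has_field_derivative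
        ?E (of_real u) - ?E (of_real u) / (K * (of_real u - of_real c)\<^sup>2)) (at (of_real u))"
    proof (rule DERIV_cong)
      have "E * (K * D) * inverse (K * D) + - (inverse (K * D) * K * inverse (K * D)) * E = E - E / (K * D\<^sup>2)"
        if "D \<noteq> 0" for E D :: complex
        using that K by (simp add: field_simps power2_eq_square)
      from this[OF u] show "?E (of_real u) * (K * (of_real u - of_real c)) * W (of_real u) +
          - (W (of_real u) * K * W (of_real u)) * ?E (of_real u) =
          ?E (of_real u) - ?E (of_real u) / (K * (of_real u - of_real c)\<^sup>2)"
        unfolding W_def .
    qed
    from has_vector_derivative_real_field[OF this]
    show "((\<lambda>u. quad_exp \<mu> y u * W (of_real u)) has_vector_derivative quad_exp \<mu> y u - R u)
        (at u within {a..b})"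
      by (simp add: quad_exp_def R_def)
  qed
  moreover have R: "R integrable_on {a..b}"
    unfolding R_def using nz K
    by (intro integrable_continuous_interval continuous_intros) auto
  ultimately have "integral {a..b} (quad_exp \<mu> y) - integral {a..b} R =
      quad_exp \<mu> y b * W (of_real b) - quad_exp \<mu> y a * W (of_real a)"
    unfolding integral_diff[OF quad_exp_integrable R, symmetric] by (intro integral_unique)
  then have "integral {a..b} (quad_exp \<mu> y) =
      quad_exp \<mu> y b * W (of_real b) - quad_exp \<mu> y a * W (of_real a) + integral {a..b} R"
    by (simp add: algebra_simps)
  moreover have "cmod (quad_exp \<mu> y b * W (of_real b) - quad_exp \<mu> y a * W (of_real a) + integral {a..b} R) \<le>
      cmod (quad_exp \<mu> y b * W (of_real b)) + cmod (quad_exp \<mu> y a * W (of_real a)) + cmod (integral {a..b} R)"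
    by (rule norm_triangle_mono[OF norm_triangle_ineq4 order.refl])
  ultimately have "cmod (integral {a..b} (quad_exp \<mu> y)) \<le>
      cmod (W (of_real b)) + cmod (W (of_real a)) + cmod (integral {a..b} R)"
    by (simp only: norm_mult norm_quad_exp mult_1)
  moreover have "cmod (W (of_real u)) = 1 / \<bar>u - c\<bar> / (2 * \<bar>\<mu>\<bar>)" for u
    unfolding W_def norm_inverse norm_mult K of_real_diff[symmetric] norm_of_real
    by (simp add: field_simps)
  moreover have "cmod (integral {a..b} R) \<le> (1 / (a - c) - 1 / (b - c)) / (2 * \<bar>\<mu>\<bar>)"
  proof -
    define k where "k = 1 / (2 * \<bar>\<mu>\<bar>)"
    have I: "((\<lambda>u. k * (inverse (u - c))\<^sup>2) has_integral
        (- k * inverse (b - c) - - k * inverse (a - c))) {a..b}"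
    proof (rule fundamental_theorem_of_calculus[OF \<open>a \<le> b\<close>])
      fix u assume "u \<in> {a..b}"
      from nz[OF this] show "((\<lambda>u. - k * inverse (u - c)) has_vector_derivative
          k * (inverse (u - c))\<^sup>2) (at u within {a..b})"
        unfolding has_real_derivative_iff_has_vector_derivative[symmetric]
        by (auto intro!: derivative_eq_intros simp: power2_eq_square)
    qed
    moreover have "norm (R u) \<le> k * (inverse (u - c))\<^sup>2" for u
      unfolding R_def norm_divide norm_mult norm_power K of_real_diff[symmetric] norm_of_real
        norm_quad_exp power2_abs
      by (simp only: k_def divide_inverse inverse_mult_distrib power_inverse mult_1_left order.refl)
    ultimately have "norm (integral {a..b} R) \<le>
        - k * inverse (b - c) - - k * inverse (a - c)"
      using integral_norm_bound_integral[OF R has_integral_integrable[OF I]]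
      unfolding integral_unique[OF I] by blast
    also have "\<dots> = (1 / (a - c) - 1 / (b - c)) / (2 * \<bar>\<mu>\<bar>)"
      by (simp only: k_def divide_inverse mult_1_left) (simp add: algebra_simps)
    finally show ?thesis .
  qed
  ultimately show ?thesis
    by (simp add: add_divide_distrib)
qed

text \<open>Second-derivative van der Corput estimate. A window of half-width \<delta> =
  |\<mu>|^(-1/2) about the critical point is bounded by its length 2\<delta>; each outer piece
  contributes at most 3\<delta>/2. The total is 5\<delta>, uniformly in y and the interval.\<close>

lemma quad_exp_integral_bound:
  fixes \<mu> y a b :: real
  assumes \<mu>: "\<mu> \<noteq> 0" and ab: "a \<le> b"
  shows "cmod (integral {a..b} (quad_exp \<mu> y)) \<le> 5 / sqrt \<bar>\<mu>\<bar>"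
proof -
  define c \<delta> where "c = - y / (2 * \<mu>)" and "\<delta> = 1 / sqrt \<bar>\<mu>\<bar>"
  have \<delta>: "\<delta> > 0" "1 / (\<bar>\<mu>\<bar> * \<delta>) = \<delta>"
    using \<mu> by (auto simp: \<delta>_def real_div_sqrt)
  \<comment> \<open>Clipping the window to the interval treats all positions of c at once; if the
    window misses the interval, then p = r.\<close>
  define p r where "p = max a (min b (c - \<delta>))" and "r = max a (min b (c + \<delta>))"
  have pr: "a \<le> p" "p \<le> r" "r \<le> b" "r - p \<le> 2 * \<delta>"
    using ab \<delta>(1) by (auto simp: p_def r_def min_def max_def)
  let ?I = "\<lambda>a b. integral {a..b} (quad_exp \<mu> y)"
  have off: "cmod (?I s t) \<le> 3 / 2 * \<delta>" if "s < t" and st: "t \<le> c - \<delta> \<or> c + \<delta> \<le> s" for s t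
  proof -
    have "cmod (?I s t) \<le> (1 / \<bar>s - c\<bar> + 1 / \<bar>t - c\<bar> + (1 / (s - c) - 1 / (t - c))) / (2 * \<bar>\<mu>\<bar>)"
      using that \<delta> by (intro quad_exp_integral_off_critical[OF \<mu> _ c_def]) auto
    also have "\<dots> \<le> (1 / \<delta> + 1 / \<delta> + 1 / \<delta>) / (2 * \<bar>\<mu>\<bar>)"
    proof (rule divide_right_mono)
      have 1: "1 / \<bar>s - c\<bar> \<le> 1 / \<delta>" "1 / \<bar>t - c\<bar> \<le> 1 / \<delta>"
        using that \<delta> by (auto intro!: divide_left_mono)
      \<comment> \<open>Both end points lie on the same side of c, so one of the two summands is
        nonpositive and the other is at most 1/\<delta>.\<close>
      have "1 / (s - c) - 1 / (t - c) \<le> 1 / \<delta>"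
      proof (cases "c + \<delta> \<le> s")
        case True
        then have "1 / (s - c) = 1 / \<bar>s - c\<bar>" "1 / (t - c) \<ge> 0" using \<delta> that by auto
        then show ?thesis using diff_mono[OF 1(1), of 0 "1 / (t - c)"] by simp
      next
        case False
        then have "\<bar>t - c\<bar> = - (t - c)" "1 / (s - c) \<le> 0" using \<delta>(1) that
          by (auto simp: divide_nonneg_neg)
        moreover from this have "- (1 / (t - c)) = 1 / \<bar>t - c\<bar>"
          by (simp only: divide_minus_right)
        ultimately show ?thesis using add_mono[OF _ 1(2), of "1 / (s - c)" 0] by simp
      qed
      with 1 show "1 / \<bar>s - c\<bar> + 1 / \<bar>t - c\<bar> + (1 / (s - c) - 1 / (t - c)) \<le> 1 / \<delta> + 1 / \<delta> + 1 / \<delta>"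
        by linarith
    qed simp
    also have "\<dots> = 3 / 2 * (1 / (\<bar>\<mu>\<bar> * \<delta>))" by (simp add: field_simps)
    finally show ?thesis unfolding \<delta>(2) .
  qed
  have "cmod (?I a p) \<le> 3 / 2 * \<delta>"
  proof (cases "a < p")
    case True
    then have "p \<le> c - \<delta>" by (auto simp: p_def max_def min_def split: if_splits)
    with True show ?thesis by (intro off) auto
  qed (use pr(1) \<delta>(1) in auto)
  moreover have "cmod (?I r b) \<le> 3 / 2 * \<delta>"
  proof (cases "r < b")
    case True
    then have "c + \<delta> \<le> r" using ab by (auto simp: r_def max_def min_def split: if_splits)
    with True show ?thesis by (intro off) auto
  qed (use pr(3) \<delta>(1) in auto)
  moreover have "cmod (?I p r) \<le> 1 * (r - p)"
    using pr by (intro integral_bound continuous_intros) auto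
  moreover have "cmod (?I a b) \<le> cmod (?I a p) + cmod (?I p r) + cmod (?I r b)"
  proof -
    have "?I a b = ?I a p + ?I p r + ?I r b"
      using Henstock_Kurzweil_Integration.integral_combine[OF _ _ quad_exp_integrable] pr
      by (metis order.trans)
    then show ?thesis by (metis norm_triangle_ineq norm_triangle_mono order.refl)
  qed
  ultimately have "cmod (?I a b) \<le> 5 * \<delta>" using pr(4) by simp
  then show ?thesis by (simp add: \<delta>_def)
qed

text \<open>A truncated parabola in place of a smooth cutoff: continuity at the end points already
  yields decay of order y^(-2) for its transform, and being a polynomial on its support it allows
  explicit antiderivatives.\<close>

definition bump :: "real \<Rightarrow> real" where
  "bump s = max 0 (1 - s\<^sup>2)"

lemma bump_bounds: "0 \<le> bump s" "bump s \<le> 1"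
  by (auto simp: bump_def)

lemma bump_eq: "bump s = indicator {-1..1} s * (1 - s\<^sup>2)"
  by (auto simp: bump_def indicator_def max_def abs_square_le_1 abs_le_iff)

lemma continuous_on_bump [continuous_intros]:
  "continuous_on S f \<Longrightarrow> continuous_on S (\<lambda>x. bump (f x))"
  unfolding bump_def by (intro continuous_intros)

lemma bump_measurable [measurable]: "bump \<in> borel_measurable borel"
  unfolding bump_def[abs_def] by measurable

section \<open>Oscillatory integrals with the bump weight\<close>

definition bump_osc :: "real \<Rightarrow> real \<Rightarrow> complex" where
  "bump_osc \<mu> y = (\<integral>s. of_real (bump s) * quad_exp \<mu> y s \<partial>lborel)"

lemma
  shows integrable_bump_quad_exp: "integrable lborel (\<lambda>s. of_real (bump s) * quad_exp \<mu> y s)"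
    and bump_osc_eq: "bump_osc \<mu> y = integral {-1..1} (\<lambda>s. of_real (1 - s\<^sup>2) * quad_exp \<mu> y s)"
proof -
  have *: "set_integrable lborel {-1..1} (\<lambda>s. of_real (1 - s\<^sup>2) * quad_exp \<mu> y s)"
    by (intro borel_integrable_atLeastAtMost' continuous_intros)
  have eq: "indicator {-1..1} s *\<^sub>R (of_real (1 - s\<^sup>2) * quad_exp \<mu> y s) = of_real (bump s) * quad_exp \<mu> y s" for s
    by (simp add: bump_eq scaleR_conv_of_real)
  show "integrable lborel (\<lambda>s. of_real (bump s) * quad_exp \<mu> y s)"
    using * unfolding set_integrable_def eq .
  show "bump_osc \<mu> y = integral {-1..1} (\<lambda>s. of_real (1 - s\<^sup>2) * quad_exp \<mu> y s)"
    using set_borel_integral_eq_integral(2)[OF *]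
    unfolding set_lebesgue_integral_def eq bump_osc_def .
qed

lemma norm_bump_osc_le: "cmod (bump_osc \<mu> y) \<le> 2"
proof -
  have "cmod (bump_osc \<mu> y) \<le> 1 * (1 - - 1)"
    unfolding bump_osc_eq
  proof (rule integral_bound)
    show "norm (of_real (1 - s\<^sup>2) * quad_exp \<mu> y s) \<le> 1" if "s \<in> {-1..1}" for s
    proof -
      have "s\<^sup>2 \<le> 1" using that by (simp add: abs_square_le_1 abs_le_iff)
      then have "\<bar>1 - s\<^sup>2\<bar> \<le> 1" by simp
      then show ?thesis by (simp only: norm_mult norm_quad_exp norm_of_real mult_1_right)
    qed
  qed (auto intro!: continuous_intros)
  then show ?thesis by simp
qed

text \<open>Integrate by parts against the primitive of \<open>quad_exp\<close>. The weight vanishes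
  at both ends, its derivative is at most 2, the primitive is at most 5/sqrt|\<mu>|, and the
  interval has length 2; hence the constant 20.\<close>

lemma bump_osc_dispersive:
  assumes "\<mu> \<noteq> 0"
  shows "cmod (bump_osc \<mu> y) \<le> 20 / sqrt \<bar>\<mu>\<bar>"
proof -
  define \<Phi> where "\<Phi> s = integral {-1..s} (quad_exp \<mu> y)" for s
  let ?f = "\<lambda>s. of_real (1 - s\<^sup>2) * quad_exp \<mu> y s - of_real (2 * s) * \<Phi> s"
  have D: "(\<Phi> has_vector_derivative quad_exp \<mu> y s) (at s within {-1..1})" if "s \<in> {-1..1}" for s
    unfolding \<Phi>_def by (rule integral_has_vector_derivative) (use that in \<open>auto intro!: continuous_intros\<close>)
  have cont: "continuous_on {-1..1} \<Phi>"
    using D by (meson continuous_on_eq_continuous_within has_vector_derivative_continuous)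
  have "(?f has_integral (of_real (1 - 1\<^sup>2) * \<Phi> 1 - of_real (1 - (- 1)\<^sup>2) * \<Phi> (- 1))) {-1..1}"
  proof (rule fundamental_theorem_of_calculus)
    fix s :: real assume s: "s \<in> {-1..1}"
    have "((\<lambda>s. complex_of_real (1 - s\<^sup>2)) has_vector_derivative of_real (- 2 * s)) (at s within {-1..1})"
      by (rule has_vector_derivative_of_real) (auto intro!: derivative_eq_intros)
    from has_vector_derivative_mult[OF this D[OF s]]
    show "((\<lambda>s. of_real (1 - s\<^sup>2) * \<Phi> s) has_vector_derivative ?f s) (at s within {-1..1})"
      by simp
  qed simp
  then have "integral {-1..1} ?f = 0" by (simp add: integral_unique)
  moreover have "integral {-1..1} ?f = bump_osc \<mu> y - integral {-1..1} (\<lambda>s. of_real (2 * s) * \<Phi> s)"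
    unfolding bump_osc_eq
    by (intro integral_diff integrable_continuous_interval continuous_intros cont)
  moreover have "cmod (integral {-1..1} (\<lambda>s. of_real (2 * s) * \<Phi> s)) \<le> (2 * (5 / sqrt \<bar>\<mu>\<bar>)) * (1 - - 1)"
  proof (rule integral_bound)
    show "norm (of_real (2 * s) * \<Phi> s) \<le> 2 * (5 / sqrt \<bar>\<mu>\<bar>)" if "s \<in> {-1..1}" for s
    proof -
      have "cmod (\<Phi> s) \<le> 5 / sqrt \<bar>\<mu>\<bar>"
        unfolding \<Phi>_def using that by (intro quad_exp_integral_bound assms) auto
      moreover have "\<bar>2 * s\<bar> \<le> 2" using that by auto
      ultimately show ?thesis
        unfolding norm_mult norm_of_real by (intro mult_mono) auto
    qed
  qed (auto intro!: continuous_intros cont)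
  ultimately show ?thesis by simp
qed

text \<open>For |y| \<le> 1 the trivial bound 2 suffices. Otherwise an explicit antiderivative loses
  its leading term at both ends, since the bump vanishes there, and each end contributes at most
  4/y^2.\<close>

lemma bump_osc_decay: "cmod (bump_osc 0 y) \<le> 16 / (1 + y\<^sup>2)"
proof (cases "\<bar>y\<bar> \<le> 1")
  case True
  then have "y\<^sup>2 \<le> 1" by (simp add: abs_square_le_1)
  then have "2 \<le> 16 / (1 + y\<^sup>2)" by (simp add: field_simps add_pos_nonneg)
  with norm_bump_osc_le[of 0 y] show ?thesis by linarith
next
  case False
  define k where "k = \<i> * complex_of_real y"
  have k: "k \<noteq> 0" "cmod k = \<bar>y\<bar>" using False by (auto simp: k_def norm_mult)
  \<comment> \<open>Result of repeated integration by parts; it stops after three terms because the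
    weight is quadratic.\<close>
  define F where "F z = exp (k * z) * ((1 - z\<^sup>2) / k + 2 * z / k\<^sup>2 - 2 / k ^ 3)" for z
  have "((\<lambda>s. of_real (1 - s\<^sup>2) * quad_exp 0 y s) has_integral F (of_real 1) - F (of_real (- 1))) {-1..1}"
  proof (rule fundamental_theorem_of_calculus)
    fix s :: real
    have "(F has_field_derivative exp (k * of_real s) * (1 - (of_real s)\<^sup>2)) (at (of_real s))"
      unfolding F_def using k
      by (auto intro!: derivative_eq_intros simp: field_simps power2_eq_square power3_eq_cube)
    from has_vector_derivative_real_field[OF this]
    show "((\<lambda>s. F (of_real s)) has_vector_derivative of_real (1 - s\<^sup>2) * quad_exp 0 y s) (at s within {-1..1})"
      by (simp add: quad_exp_def k_def mult_ac)
  qed simp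
  then have "bump_osc 0 y = F 1 - F (- 1)"
    unfolding bump_osc_eq by (simp add: integral_unique)
  also have "cmod \<dots> \<le> cmod (F 1) + cmod (F (- 1))" by (rule norm_triangle_ineq4)
  also have "cmod (F z) \<le> 4 / y\<^sup>2" if "z = 1 \<or> z = - 1" for z
  proof -
    have e: "cmod (exp (k * z)) = 1" "cmod z = 1" "1 - z\<^sup>2 = 0" using that by (auto simp: k_def)
    have "cmod (F z) = cmod (2 * z / k\<^sup>2 - 2 / k ^ 3)"
      unfolding F_def norm_mult e by simp
    also have "\<dots> \<le> cmod (2 * z / k\<^sup>2) + cmod (2 / k ^ 3)" by (rule norm_triangle_ineq4)
    also have "\<dots> = 2 / y\<^sup>2 + 2 / (y\<^sup>2 * \<bar>y\<bar>)"
      by (simp add: norm_divide norm_mult norm_power e k power3_eq_cube power2_eq_square)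
    also have "2 / (y\<^sup>2 * \<bar>y\<bar>) \<le> 2 / (y\<^sup>2 * 1)"
      using False by (intro divide_left_mono mult_left_mono) auto
    finally show ?thesis by simp
  qed
  from add_mono[OF this[of 1] this[of "- 1"]] have "cmod (F 1) + cmod (F (- 1)) \<le> 8 / y\<^sup>2" by simp
  also have "\<dots> \<le> 16 / (1 + y\<^sup>2)"
  proof -
    have "1 \<le> y\<^sup>2" using False by (metis abs_square_le_1 linorder_not_le order.strict_iff_order)
    moreover have "8 / Y \<le> 16 / (1 + Y)" if "1 \<le> Y" for Y :: real
      using that by (simp add: field_simps)
    ultimately show ?thesis by simp
  qed
  finally show ?thesis .
qed

text \<open>This is the gain of |l|^(-1) from the linear variable. On [1,3] the factor 9/t^2 is at
  least 1, and inserting it turns the integrand into the exact derivative of -(9/l) arctan(y + l/t),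
  whose variation is controlled by the range of arctan, uniformly in y.\<close>

lemma arctan_integral_bound:
  fixes y l :: real
  assumes l: "l \<noteq> 0"
  shows "integrable lborel (\<lambda>t. indicator {1..3} t * (1 / (1 + (y + l / t)\<^sup>2)))"
    and "(\<integral>t. indicator {1..3} t * (1 / (1 + (y + l / t)\<^sup>2)) \<partial>lborel) \<le> 9 * pi / \<bar>l\<bar>"
proof -
  have pos: "1 + x\<^sup>2 > 0" for x :: real by (simp add: add_pos_nonneg)
  have "set_integrable lborel {1..3} (\<lambda>t. 1 / (1 + (y + l / t)\<^sup>2))"
    by (intro borel_integrable_atLeastAtMost' continuous_intros) (auto simp: pos less_imp_neq[OF pos, symmetric])
  then show int: "integrable lborel (\<lambda>t. indicator {1..3} t * (1 / (1 + (y + l / t)\<^sup>2)))"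
    by (simp add: set_integrable_def)
  let ?F = "\<lambda>t. - (9 / l) * arctan (y + l / t)"
  let ?f = "\<lambda>t. 9 / t\<^sup>2 * (1 / (1 + (y + l / t)\<^sup>2))"
  have hb: "has_bochner_integral lborel (\<lambda>t. indicator {1..3} t *\<^sub>R ?f t) (?F 3 - ?F 1)"
  proof (rule has_bochner_integral_FTC_Icc)
    fix t :: real assume "1 \<le> t" "t \<le> 3"
    then have "((\<lambda>t. y + l / t) has_real_derivative - l / t\<^sup>2) (at t within {1..3})"
      by (auto intro!: derivative_eq_intros simp: power2_eq_square)
    from DERIV_cmult[OF DERIV_chain2[OF DERIV_arctan this], of "- (9 / l)"]
    have "(?F has_real_derivative ?f t) (at t within {1..3})"
      by (rule DERIV_cong) (use l in \<open>simp add: divide_inverse\<close>)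
    then show "(?F has_vector_derivative ?f t) (at t within {1..3})"
      unfolding has_real_derivative_iff_has_vector_derivative .
  next
    show "continuous_on {1..3} ?f"
      by (intro continuous_intros) (auto simp: less_imp_neq[OF pos, symmetric])
  qed simp
  have "(\<integral>t. indicator {1..3} t * (1 / (1 + (y + l / t)\<^sup>2)) \<partial>lborel) \<le> (\<integral>t. indicator {1..3} t *\<^sub>R ?f t \<partial>lborel)"
  proof (rule integral_mono[OF int integrable.intros[OF hb]])
    fix t :: real
    show "indicator {1..3} t * (1 / (1 + (y + l / t)\<^sup>2)) \<le> indicator {1..3} t *\<^sub>R ?f t"
    proof (cases "t \<in> {1..3}")
      case True
      then have "t\<^sup>2 \<le> 3\<^sup>2" by (intro power_mono) auto
      then have "1 \<le> 9 / t\<^sup>2" using True by (simp add: field_simps)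
      from mult_right_mono[OF this, of "1 / (1 + (y + l / t)\<^sup>2)"]
      show ?thesis using True pos[of "y + l / t"] by simp
    qed simp
  qed
  also have "\<dots> = (9 / l) * (arctan (y + l) - arctan (y + l / 3))"
    using has_bochner_integral_integral_eq[OF hb] by (simp add: algebra_simps)
  also have "\<dots> \<le> \<bar>9 / l\<bar> * \<bar>arctan (y + l) - arctan (y + l / 3)\<bar>"
    by (metis abs_ge_self abs_mult)
  also have "\<dots> \<le> \<bar>9 / l\<bar> * pi"
    using arctan_lbound[of "y + l"] arctan_ubound[of "y + l"] arctan_lbound[of "y + l / 3"] arctan_ubound[of "y + l / 3"]
    by (intro mult_left_mono) auto
  finally show "(\<integral>t. indicator {1..3} t * (1 / (1 + (y + l / t)\<^sup>2)) \<partial>lborel) \<le> 9 * pi / \<bar>l\<bar>"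
    by simp
qed

section \<open>The dispersive estimate\<close>

text \<open>The shift by 2 along e puts the support where 1 \<le> \<open>x \<bullet> e\<close> \<le>
  3 and the other coordinates are at most 1 in modulus, so the explicit formula for the phase holds
  on it.\<close>

definition bump_prod :: "'a \<Rightarrow> 'a::euclidean_space \<Rightarrow> real" where
  "bump_prod e x = (\<Prod>b\<in>Basis. bump (x \<bullet> b - (if b = e then 2 else 0)))"

text \<open>The maximum makes the phase globally continuous; it is only used where
  \<open>x \<bullet> e \<ge> 1\<close>.\<close>

definition model_phase :: "'a \<Rightarrow> 'a \<Rightarrow> 'a::euclidean_space \<Rightarrow> real" where
  "model_phase e e2 x = (\<Sum>b\<in>Basis - {e}. coord_phase e2 b (x \<bullet> b / max 1 (x \<bullet> e)))"

definition model_sym :: "'a \<Rightarrow> 'a \<Rightarrow> real \<Rightarrow> 'a::euclidean_space \<Rightarrow> complex" where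
  "model_sym e e2 l x = exp (\<i> * of_real (l * model_phase e e2 x)) * of_real (bump_prod e x)"

lemma bump_prod_bounds: "0 \<le> bump_prod e x" "bump_prod e x \<le> 1"
  unfolding bump_prod_def by (auto intro!: prod_nonneg prod_le_1 bump_bounds)

lemma bump_eq_0: "bump s = 0 \<longleftrightarrow> \<bar>s\<bar> \<ge> 1"
  using abs_le_square_iff[of 1 s] by (auto simp: bump_def max_def)

lemma bump_prod_nonzero:
  assumes "e \<in> Basis" "bump_prod e x \<noteq> 0"
  shows "1 \<le> x \<bullet> e" "x \<bullet> e \<le> 3" "b \<in> Basis - {e} \<Longrightarrow> \<bar>x \<bullet> b\<bar> \<le> 1"
proof -
  have *: "\<bar>x \<bullet> b - (if b = e then 2 else 0)\<bar> < 1" if "b \<in> Basis" for b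
    using assms(2) that unfolding bump_prod_def by (force simp: bump_eq_0)
  show "1 \<le> x \<bullet> e" "x \<bullet> e \<le> 3" using *[OF assms(1)] by auto
  show "b \<in> Basis - {e} \<Longrightarrow> \<bar>x \<bullet> b\<bar> \<le> 1" using *[of b] by auto
qed

lemma phase_symbol_bump_prod:
  assumes "e \<in> Basis"
  shows "phase_symbol (phase_fun e e2) l x * of_real (bump_prod e x) = model_sym e e2 l x"
proof (cases "bump_prod e x = 0")
  case False
  have "phase_fun e e2 (x /\<^sub>R norm x) = model_phase e e2 x"
    unfolding model_phase_def
    by (rule phase_fun_normalized[OF assms]) (use bump_prod_nonzero[OF assms False] in auto)
  then show ?thesis
    by (simp add: phase_symbol_def model_sym_def)
qed (simp add: model_sym_def)

text \<open>Group law in the parameter: any model symbol can serve as the datum and any other as its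
  image, in particular both the pair from 0 to l and the pair from -l to 0.\<close>

lemma phase_symbol_model_sym:
  assumes "e \<in> Basis"
  shows "phase_symbol (phase_fun e e2) l x * model_sym e e2 k x = model_sym e e2 (l + k) x"
proof -
  have "phase_symbol (phase_fun e e2) l x * model_sym e e2 k x =
      exp (\<i> * of_real (k * model_phase e e2 x)) * (phase_symbol (phase_fun e e2) l x * of_real (bump_prod e x))"
    by (simp add: model_sym_def)
  also have "\<dots> = model_sym e e2 (l + k) x"
    unfolding phase_symbol_bump_prod[OF assms]
    by (simp add: model_sym_def distrib_right distrib_left exp_add)
  finally show ?thesis .
qed

lemma norm_model_sym: "cmod (model_sym e e2 l x) = bump_prod e x"
  by (simp add: model_sym_def norm_mult bump_prod_bounds)

lemma continuous_on_model_sym: "continuous_on UNIV (model_sym e e2 l)"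
proof -
  have "continuous_on UNIV (\<lambda>x::'a. coord_phase e2 b (x \<bullet> b / max 1 (x \<bullet> e)))" for b
    by (cases "b = e2") (auto simp: coord_phase_def intro!: continuous_intros)
  then show ?thesis
    unfolding model_sym_def model_phase_def bump_prod_def by (intro continuous_intros)
qed

lemma integrable_bump: "integrable lborel bump"
proof -
  have "quad_exp 0 0 s = 1" for s by (simp add: quad_exp_def)
  then show ?thesis
    using integrable_bump_quad_exp[of 0 0] by (simp add: complex_of_real_integrable_eq)
qed

lemma integrable_bump_prod: "integrable lborel (bump_prod (e::'a::euclidean_space))"
proof -
  let ?f = "\<lambda>b s. complex_of_real (bump (s - (if b = e then 2 else 0)))"
  have "integrable lborel (?f b)" for b
    using integrable_lborel_affine[of 1 "\<lambda>s::real. complex_of_real (bump s)" "- (if b = e then 2 else 0)"] integrable_bump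
    by (simp add: complex_of_real_integrable_eq)
  from integrable_lborel_prod[of ?f, OF this] show ?thesis
    by (simp add: bump_prod_def[abs_def] complex_of_real_integrable_eq flip: of_real_prod)
qed

lemma integrable_model_sym: "integrable lborel (model_sym e e2 l)"
proof (rule Bochner_Integration.integrable_bound[OF integrable_bump_prod[of e]])
  show "model_sym e e2 l \<in> borel_measurable lborel"
    using borel_measurable_continuous_onI[OF continuous_on_model_sym[of e e2 l]] by simp
qed (simp add: norm_model_sym bump_prod_bounds)

text \<open>For frozen t the total phase is a sum of one-variable polynomials: along e2 it is linear
  with slope shifted by l/t, along every other direction quadratic with coefficient l/t^2. Each
  variable therefore integrates to a \<open>bump_osc\<close>.\<close>

lemma inv_fourier_model_sym:
  fixes e e2 x :: "'a::euclidean_space" and l :: real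
  assumes e: "e \<in> Basis"
  defines "\<mu> \<equiv> \<lambda>b t. if b = e2 then 0 else l / (max 1 t)\<^sup>2"
    and "y \<equiv> \<lambda>b t. 2 * pi * (x \<bullet> b) + (if b = e2 then l / max 1 t else 0)"
  shows "inv_fourier (model_sym e e2 l) x = (\<integral>t. of_real (bump (t - 2)) * exp (\<i> * of_real (2 * pi * (x \<bullet> e) * t)) *
    (\<Prod>b\<in>Basis - {e}. bump_osc (\<mu> b t) (y b t)) \<partial>lborel)"
proof -
  let ?u = "\<lambda>t. of_real (bump (t - 2)) * exp (\<i> * of_real (2 * pi * (x \<bullet> e) * t)) :: complex"
  let ?v = "\<lambda>b t s. of_real (bump s) * quad_exp (\<mu> b t) (y b t) s"
  have eq: "model_sym e e2 l \<xi> * exp (2 * of_real pi * \<i> * of_real (x \<bullet> \<xi>)) =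
      ?u (\<xi> \<bullet> e) * (\<Prod>b\<in>Basis - {e}. ?v b (\<xi> \<bullet> e) (\<xi> \<bullet> b))" for \<xi>
  proof -
    have bp: "bump_prod e \<xi> = bump (\<xi> \<bullet> e - 2) * (\<Prod>b\<in>Basis - {e}. bump (\<xi> \<bullet> b))"
    proof -
      have "(\<Prod>b\<in>Basis - {e}. bump (\<xi> \<bullet> b - (if b = e then 2 else 0))) = (\<Prod>b\<in>Basis - {e}. bump (\<xi> \<bullet> b))"
        by (intro prod.cong) auto
      then show ?thesis using e by (simp add: bump_prod_def prod.remove[of Basis e])
    qed
    have ph: "l * coord_phase e2 b (s / max 1 t) + 2 * pi * (x \<bullet> b) * s = \<mu> b t * s\<^sup>2 + y b t * s" for b s t
      by (simp add: coord_phase_def \<mu>_def y_def power2_eq_square algebra_simps)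
    have "l * model_phase e e2 \<xi> + 2 * pi * (x \<bullet> \<xi>) =
      2 * pi * (x \<bullet> e) * (\<xi> \<bullet> e) + (\<Sum>b\<in>Basis - {e}. l * coord_phase e2 b (\<xi> \<bullet> b / max 1 (\<xi> \<bullet> e)) + 2 * pi * (x \<bullet> b) * (\<xi> \<bullet> b))"
      unfolding model_phase_def euclidean_inner[of x \<xi>] using e
      by (simp add: sum.remove[of Basis e] sum.distrib sum_distrib_left algebra_simps)
    also have "\<dots> = 2 * pi * (x \<bullet> e) * (\<xi> \<bullet> e) +
        (\<Sum>b\<in>Basis - {e}. \<mu> b (\<xi> \<bullet> e) * (\<xi> \<bullet> b)\<^sup>2 + y b (\<xi> \<bullet> e) * (\<xi> \<bullet> b))"
      unfolding ph ..
    finally have sum: "l * model_phase e e2 \<xi> + 2 * pi * (x \<bullet> \<xi>) = 2 * pi * (x \<bullet> e) * (\<xi> \<bullet> e) +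
        (\<Sum>b\<in>Basis - {e}. \<mu> b (\<xi> \<bullet> e) * (\<xi> \<bullet> b)\<^sup>2 + y b (\<xi> \<bullet> e) * (\<xi> \<bullet> b))" (is "_ = _ + ?S") .
    have "(\<Prod>b\<in>Basis - {e}. quad_exp (\<mu> b (\<xi> \<bullet> e)) (y b (\<xi> \<bullet> e)) (\<xi> \<bullet> b)) = exp (\<i> * of_real ?S)"
      by (simp only: quad_exp_def exp_sum[symmetric] finite_Diff finite_Basis of_real_sum sum_distrib_left)
    then have "exp (\<i> * of_real (2 * pi * (x \<bullet> e) * (\<xi> \<bullet> e))) *
        (\<Prod>b\<in>Basis - {e}. quad_exp (\<mu> b (\<xi> \<bullet> e)) (y b (\<xi> \<bullet> e)) (\<xi> \<bullet> b)) =
      exp (\<i> * of_real (l * model_phase e e2 \<xi> + 2 * pi * (x \<bullet> \<xi>)))"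
      unfolding sum by (simp only: of_real_add distrib_left exp_add)
    also have "\<dots> = exp (\<i> * of_real (l * model_phase e e2 \<xi>)) * exp (2 * of_real pi * \<i> * of_real (x \<bullet> \<xi>))"
      by (simp add: distrib_left exp_add mult_ac)
    finally have "exp (\<i> * of_real (l * model_phase e e2 \<xi>)) * exp (2 * of_real pi * \<i> * of_real (x \<bullet> \<xi>)) =
      exp (\<i> * of_real (2 * pi * (x \<bullet> e) * (\<xi> \<bullet> e))) *
        (\<Prod>b\<in>Basis - {e}. quad_exp (\<mu> b (\<xi> \<bullet> e)) (y b (\<xi> \<bullet> e)) (\<xi> \<bullet> b))" ..
    then show ?thesis
      by (simp add: model_sym_def bp prod.distrib mult_ac)
  qed
  have int: "integrable lborel (\<lambda>\<xi>. ?u (\<xi> \<bullet> e) * (\<Prod>b\<in>Basis - {e}. ?v b (\<xi> \<bullet> e) (\<xi> \<bullet> b)))"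
    unfolding eq[symmetric]
  proof (rule Bochner_Integration.integrable_bound[OF integrable_model_sym[of e e2 l]])
    have [measurable]: "model_sym e e2 l \<in> borel_measurable borel"
      using borel_measurable_continuous_onI[OF continuous_on_model_sym[of e e2 l]] by simp
    show "(\<lambda>\<xi>. model_sym e e2 l \<xi> * exp (2 * of_real pi * \<i> * of_real (x \<bullet> \<xi>))) \<in> borel_measurable lborel"
      by simp
  qed (simp add: norm_mult)
  have M: "(\<lambda>t. \<integral>s. ?v b t s \<partial>lborel) \<in> borel_measurable borel" for b
    unfolding quad_exp_def \<mu>_def y_def by measurable
  have "(\<lambda>t. ?u t * (\<Prod>b\<in>Basis - {e}. \<integral>s. ?v b t s \<partial>lborel)) \<in> borel_measurable borel"
    by (intro M borel_measurable_times borel_measurable_prod) measurable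
  from integral_lborel_split[OF e int integrable_bump_quad_exp this] show ?thesis
    unfolding inv_fourier_def eq bump_osc_def .
qed

text \<open>The d - 2 quadratic directions are bounded uniformly in t. The e2 factor is kept as a
  function of t, because it is small only where \<open>?y + l / t\<close> is large; integrating its
  decay over t gives 16 * 9 pi/|l|, which accounts for 144 pi.\<close>

lemma inv_fourier_model_sym_bound:
  fixes e e2 x :: "'a::euclidean_space"
  assumes e: "e \<in> Basis" "e2 \<in> Basis" "e2 \<noteq> e" and l: "l \<noteq> 0"
  shows "cmod (inv_fourier (model_sym e e2 l) x) \<le> 144 * pi * 60 ^ (DIM('a) - 2) * \<bar>l\<bar> powr (- (real DIM('a) / 2))"
proof -
  let ?n = "DIM('a) - 2"
  let ?y = "2 * pi * (x \<bullet> e2)"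
  define C where "C = 16 * (60 / sqrt \<bar>l\<bar>) ^ ?n"
  define \<mu> where "\<mu> = (\<lambda>b t. if b = e2 then 0 else l / (max 1 t)\<^sup>2)"
  define y where "y = (\<lambda>b t. 2 * pi * (x \<bullet> b) + (if b = e2 then l / max 1 t else 0))"
  let ?B = "Basis - {e} - {e2}"
  have B: "card ?B = ?n" "card (Basis :: 'a set) \<ge> 2"
  proof -
    show "card ?B = ?n" using e by (simp add: card_Diff_singleton)
    have "card {e, e2} \<le> card (Basis :: 'a set)" using e by (intro card_mono) auto
    then show "card (Basis :: 'a set) \<ge> 2" using e by simp
  qed
  have le: "norm (of_real (bump (t - 2)) * exp (\<i> * of_real (2 * pi * (x \<bullet> e) * t)) *
      (\<Prod>b\<in>Basis - {e}. bump_osc (\<mu> b t) (y b t))) \<le> C * (indicator {1..3} t * (1 / (1 + (?y + l / t)\<^sup>2)))" for t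
  proof (cases "t \<in> {1..3}")
    case False
    then have "bump (t - 2) = 0" by (auto simp: bump_eq_0)
    then show ?thesis using False by simp
  next
    case True
    then have m: "max 1 t = t" "t > 0" by auto
    have 1: "cmod (bump_osc (\<mu> e2 t) (y e2 t)) \<le> 16 / (1 + (?y + l / t)\<^sup>2)"
      using bump_osc_decay by (simp add: \<mu>_def y_def m)
    \<comment> \<open>The dispersive constant 20 acquires the factor t \<le> 3 from the coefficient
      l/t^2, giving 60.\<close>
    have 2: "cmod (bump_osc (\<mu> b t) (y b t)) \<le> 60 / sqrt \<bar>l\<bar>" if "b \<in> ?B" for b
    proof -
      have "cmod (bump_osc (\<mu> b t) (y b t)) \<le> 20 / sqrt \<bar>\<mu> b t\<bar>"
        using that l m by (intro bump_osc_dispersive) (auto simp: \<mu>_def)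
      also have "\<dots> = 20 * t / sqrt \<bar>l\<bar>"
        using that m by (simp add: \<mu>_def real_sqrt_divide)
      also have "\<dots> \<le> 60 / sqrt \<bar>l\<bar>"
        using True by (intro divide_right_mono) auto
      finally show ?thesis .
    qed
    have "cmod (\<Prod>b\<in>?B. bump_osc (\<mu> b t) (y b t)) \<le> (60 / sqrt \<bar>l\<bar>) ^ ?n"
      unfolding prod_norm[symmetric] B(1)[symmetric] prod_constant[symmetric]
      by (intro prod_mono) (use 2 in auto)
    then have "bump (t - 2) * (cmod (bump_osc (\<mu> e2 t) (y e2 t)) * cmod (\<Prod>b\<in>?B. bump_osc (\<mu> b t) (y b t))) \<le>
        1 * (16 / (1 + (?y + l / t)\<^sup>2) * (60 / sqrt \<bar>l\<bar>) ^ ?n)"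
      using 1 by (intro mult_mono bump_bounds) (auto intro!: mult_nonneg_nonneg add_nonneg_nonneg divide_nonneg_nonneg)
    moreover have "(\<Prod>b\<in>Basis - {e}. bump_osc (\<mu> b t) (y b t)) =
        bump_osc (\<mu> e2 t) (y e2 t) * (\<Prod>b\<in>?B. bump_osc (\<mu> b t) (y b t))"
      using e by (intro prod.remove) auto
    ultimately show ?thesis
      using True by (simp add: norm_mult bump_bounds C_def mult_ac)
  qed
  note I = arctan_integral_bound[OF l, of ?y]
  have C: "C \<ge> 0" using l by (simp add: C_def)
  have "cmod (inv_fourier (model_sym e e2 l) x) \<le>
      (\<integral>t. C * (indicator {1..3} t * (1 / (1 + (?y + l / t)\<^sup>2))) \<partial>lborel)"
    unfolding inv_fourier_model_sym[OF e(1)] \<mu>_def[symmetric] y_def[symmetric]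
  proof (rule order.trans[OF integral_norm_bound integral_mono'])
    show "integrable lborel (\<lambda>t. C * (indicator {1..3} t * (1 / (1 + (?y + l / t)\<^sup>2))))"
      by (intro integrable_mult_right I(1))
  qed (use le order.trans[OF norm_ge_zero le] in \<open>simp_all only: \<mu>_def y_def\<close>)
  also have "\<dots> \<le> C * (9 * pi / \<bar>l\<bar>)"
    using I(2) C by (simp only: integral_mult_right_zero) (rule mult_left_mono)
  also have "\<dots> = 144 * pi * 60 ^ ?n * (\<bar>l\<bar> powr (- 1) * (\<bar>l\<bar> powr (- (1 / 2))) ^ ?n)"
  proof -
    have "60 / sqrt \<bar>l\<bar> = 60 * \<bar>l\<bar> powr (- (1 / 2))" "9 * pi / \<bar>l\<bar> = 9 * pi * \<bar>l\<bar> powr (- 1)"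
      using l by (simp_all add: powr_minus_divide powr_half_sqrt)
    then show ?thesis
      by (simp only: C_def power_mult_distrib) simp
  qed
  \<comment> \<open>Exponents add up to -1 - (d - 2)/2 = -d/2; the natural subtraction is exact
    because two distinct basis vectors force d \<ge> 2.\<close>
  also have "\<bar>l\<bar> powr (- 1) * (\<bar>l\<bar> powr (- (1 / 2))) ^ ?n = \<bar>l\<bar> powr (- (real DIM('a) / 2))"
  proof -
    have "- 1 + real ?n * - (1 / 2) = - (real DIM('a) / 2)"
      using B(2) by (simp add: of_nat_diff field_simps)
    then show ?thesis
      using l by (simp only: powr_power powr_add[symmetric] abs_eq_0 simp_thms)
  qed
  finally show ?thesis .
qed

section \<open>Norm bounds for the multiplier\<close>

lemma ennreal_div_mono:
  assumes "ennreal x \<le> a" "b \<le> ennreal y" "b \<noteq> 0" "0 \<le> x" "0 < y"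
  shows "ennreal (x / y) \<le> a / b"
proof -
  obtain r where r: "b = ennreal r" "0 < r" "r \<le> y"
    using assms by (cases b) (auto simp: top_unique order.strict_iff_order)
  have "ennreal (x / y) \<le> ennreal (x / r)"
    using r assms by (intro ennreal_leI divide_left_mono) auto
  also have "\<dots> = ennreal x / b" using r assms by (simp add: divide_ennreal)
  also have "\<dots> \<le> a / b" by (rule divide_right_mono_ennreal[OF assms(1)])
  finally show ?thesis .
qed

text \<open>Replaces roots of order p by constants free of p, so that one final constant serves all
  exponents.\<close>

lemma powr_inverse_bounds:
  fixes x p :: real
  assumes "x > 0" "p \<ge> 1"
  shows "min 1 x \<le> x powr (1 / p)" "x powr (1 / p) \<le> max 1 x"
proof -
  have p: "0 \<le> 1 / p" "1 / p \<le> 1" using assms(2) by auto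
  have "min 1 x \<le> x powr (1 / p) \<and> x powr (1 / p) \<le> max 1 x"
  proof (cases "x \<ge> 1")
    case True
    then show ?thesis
      using powr_mono[OF p(2), of x] powr_mono[OF p(1), of x] assms by simp
  next
    case False
    then show ?thesis
      using powr_mono'[OF p(2), of x] powr_mono'[OF p(1), of x] assms by simp
  qed
  then show "min 1 x \<le> x powr (1 / p)" "x powr (1 / p) \<le> max 1 x" by auto
qed

section \<open>Interpolation with the sup norm\<close>

lemma Lp_norm_ge:
  assumes p: "p > 0" and g: "ennreal r \<le> (\<integral>\<^sup>+x. ennreal (cmod (g x) powr p) \<partial>lborel)" "r \<ge> 0"
  shows "ennreal (r powr (1 / p)) \<le> Lp_norm p g"
proof (cases "\<integral>\<^sup>+x. ennreal (cmod (g x) powr p) \<partial>lborel")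
  case (real s)
  with g have "r \<le> s" by simp
  then have "r powr (1 / p) \<le> s powr (1 / p)" using p g(2) by (intro powr_mono2) auto
  then show ?thesis using Lp_norm_eq[OF real(2,1)] by (simp add: ennreal_leI)
qed (simp add: Lp_norm_def)

lemma Lp_norm_le:
  assumes p: "p > 0" and g: "(\<integral>\<^sup>+x. ennreal (cmod (g x) powr p) \<partial>lborel) \<le> ennreal r" "r \<ge> 0"
  shows "Lp_norm p g \<le> ennreal (r powr (1 / p))"
proof (cases "\<integral>\<^sup>+x. ennreal (cmod (g x) powr p) \<partial>lborel")
  case (real s)
  with g have "s \<le> r" by simp
  then have "s powr (1 / p) \<le> r powr (1 / p)" using p real by (intro powr_mono2) auto
  then show ?thesis using Lp_norm_eq[OF real(2,1)] by (simp add: ennreal_leI)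
qed (use g in \<open>simp add: top_unique\<close>)

text \<open>Pointwise, p - q of the p powers of |f| are bounded by the sup bound N. Used with q = 1
  for the undispersed function and with q = 2 for the dispersed one.\<close>

lemma Lp_norm_upper_interpolation:
  assumes q: "0 < q" "q \<le> p" and N: "N > 0" "\<And>x. cmod (f x) \<le> N"
    and f [measurable]: "f \<in> borel_measurable borel"
    and I: "(\<integral>\<^sup>+x. ennreal (cmod (f x) powr q) \<partial>lborel) \<le> ennreal A" "A \<ge> 0"
  shows "Lp_norm p f \<le> ennreal (A powr (1 / p) * N powr (1 - q / p))"
proof -
  have "cmod (f x) powr p \<le> N powr (p - q) * cmod (f x) powr q" for x
  proof -
    have "cmod (f x) powr p = cmod (f x) powr (p - q) * cmod (f x) powr q"
      by (simp flip: powr_add)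
    also have "\<dots> \<le> N powr (p - q) * cmod (f x) powr q"
      using q N by (intro mult_right_mono powr_mono2) auto
    finally show ?thesis .
  qed
  then have "(\<integral>\<^sup>+x. ennreal (cmod (f x) powr p) \<partial>lborel) \<le>
      (\<integral>\<^sup>+x. ennreal (N powr (p - q)) * ennreal (cmod (f x) powr q) \<partial>lborel)"
    by (intro nn_integral_mono) (simp flip: ennreal_mult)
  also have "\<dots> = ennreal (N powr (p - q)) * (\<integral>\<^sup>+x. ennreal (cmod (f x) powr q) \<partial>lborel)"
    by (intro nn_integral_cmult) simp
  also have "\<dots> \<le> ennreal (N powr (p - q)) * ennreal A"
    by (intro mult_left_mono I) simp
  also have "\<dots> = ennreal (A * N powr (p - q))"
    using I by (simp add: ennreal_mult mult.commute)
  finally have "Lp_norm p f \<le> ennreal ((A * N powr (p - q)) powr (1 / p))"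
    using q I by (intro Lp_norm_le) auto
  also have "(A * N powr (p - q)) powr (1 / p) = A powr (1 / p) * N powr (1 - q / p)"
    using q I by (simp add: powr_mult powr_powr diff_divide_distrib)
  finally show ?thesis .
qed

text \<open>Since p - 2 \<le> 0, a small sup bound makes |f|^(p-2) large: a spread-out function of
  fixed L2 norm must have a large Lp norm.\<close>

lemma Lp_norm_lower_interpolation:
  assumes p: "0 < p" "p \<le> 2" and N: "N > 0" "\<And>x. cmod (f x) \<le> N"
    and f [measurable]: "f \<in> borel_measurable borel"
    and I: "(\<integral>\<^sup>+x. ennreal ((cmod (f x))\<^sup>2) \<partial>lborel) = ennreal A" "A \<ge> 0"
  shows "ennreal (A powr (1 / p) * N powr (1 - 2 / p)) \<le> Lp_norm p f"
proof -
  have "(cmod (f x))\<^sup>2 * N powr (p - 2) \<le> cmod (f x) powr p" for x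
  proof (cases "f x = 0")
    case False
    have "N powr (p - 2) \<le> cmod (f x) powr (p - 2)"
      using p N(2)[of x] False by (intro powr_mono2') auto
    then have "(cmod (f x))\<^sup>2 * N powr (p - 2) \<le> (cmod (f x))\<^sup>2 * cmod (f x) powr (p - 2)"
      by (intro mult_left_mono) auto
    also have "\<dots> = cmod (f x) powr p"
      using False by (simp add: powr_diff powr_numeral)
    finally show ?thesis .
  qed simp
  then have "(\<integral>\<^sup>+x. ennreal ((cmod (f x))\<^sup>2) * ennreal (N powr (p - 2)) \<partial>lborel) \<le>
      (\<integral>\<^sup>+x. ennreal (cmod (f x) powr p) \<partial>lborel)"
    by (intro nn_integral_mono) (simp flip: ennreal_mult)
  then have "ennreal (A * N powr (p - 2)) \<le> (\<integral>\<^sup>+x. ennreal (cmod (f x) powr p) \<partial>lborel)"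
    using I by (simp add: nn_integral_multc ennreal_mult)
  then have "ennreal ((A * N powr (p - 2)) powr (1 / p)) \<le> Lp_norm p f"
    using p I by (intro Lp_norm_ge) auto
  also have "(A * N powr (p - 2)) powr (1 / p) = A powr (1 / p) * N powr (1 - 2 / p)"
    using p I by (simp add: powr_mult powr_powr diff_divide_distrib)
  finally show ?thesis .
qed

text \<open>Split at height \<delta>. Values below it carry at most half of the L2 mass, by the L1
  bound; above it |f|^2 is at most M^2 (|f|/\<delta>)^p. The remaining half forces a lower bound on
  the Lp norm, with a constant independent of p.\<close>

lemma Lp_norm_lower_uniform:
  fixes f :: "'a::euclidean_space \<Rightarrow> complex"
  assumes M: "M > 0" "\<And>x. cmod (f x) \<le> M"
    and f [measurable]: "f \<in> borel_measurable borel"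
    and L: "(\<integral>\<^sup>+x. ennreal (cmod (f x)) \<partial>lborel) \<le> ennreal L" "L \<ge> 0"
    and I: "(\<integral>\<^sup>+x. ennreal ((cmod (f x))\<^sup>2) \<partial>lborel) = ennreal A" "A > 0"
  obtains \<beta> where "\<beta> > 0" "\<And>p. p \<ge> 1 \<Longrightarrow> ennreal \<beta> \<le> Lp_norm p f"
proof
  \<comment> \<open>Chosen so that \<delta> L \<le> A/2; adding 1 keeps the denominator positive
    when L = 0.\<close>
  define \<delta> where "\<delta> = A / (2 * (L + 1))"
  have \<delta>: "\<delta> > 0" "\<delta> * L \<le> A / 2"
    using I L by (auto simp: \<delta>_def field_simps)
  show "\<delta> * min 1 (A / (2 * M\<^sup>2)) > 0" using \<delta> I M by simp
  fix p :: real assume p: "p \<ge> 1"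
  have le: "(cmod (f x))\<^sup>2 \<le> \<delta> * cmod (f x) + M\<^sup>2 / \<delta> powr p * cmod (f x) powr p" for x
  proof (cases "cmod (f x) \<le> \<delta>")
    case True
    then have "(cmod (f x))\<^sup>2 \<le> \<delta> * cmod (f x)"
      by (simp add: power2_eq_square mult_right_mono)
    then show ?thesis by (simp add: add_increasing2)
  next
    case False
    then have "\<delta> powr p \<le> cmod (f x) powr p" using \<delta> p by (intro powr_mono2) auto
    then have "1 \<le> cmod (f x) powr p / \<delta> powr p" using \<delta> by simp
    then have "M\<^sup>2 * 1 \<le> M\<^sup>2 * (cmod (f x) powr p / \<delta> powr p)" by (intro mult_left_mono) auto
    moreover have "(cmod (f x))\<^sup>2 \<le> M\<^sup>2" using M by (intro power_mono) auto
    moreover have "0 \<le> \<delta> * cmod (f x)" using \<delta> by simp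
    ultimately show ?thesis by simp
  qed
  define J where "J = (\<integral>\<^sup>+x. ennreal (cmod (f x) powr p) \<partial>lborel)"
  have "ennreal A \<le> (\<integral>\<^sup>+x. ennreal \<delta> * ennreal (cmod (f x)) + ennreal (M\<^sup>2 / \<delta> powr p) * ennreal (cmod (f x) powr p) \<partial>lborel)"
    unfolding I(1)[symmetric] using le \<delta>
    by (intro nn_integral_mono) (simp flip: ennreal_mult ennreal_plus)
  also have "\<dots> = ennreal \<delta> * (\<integral>\<^sup>+x. ennreal (cmod (f x)) \<partial>lborel) + ennreal (M\<^sup>2 / \<delta> powr p) * J"
    unfolding J_def by (simp add: nn_integral_add nn_integral_cmult)
  also have "\<dots> \<le> ennreal \<delta> * ennreal L + ennreal (M\<^sup>2 / \<delta> powr p) * J"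
    using L by (intro add_mono mult_left_mono) auto
  also have "\<dots> \<le> ennreal (A / 2) + ennreal (M\<^sup>2 / \<delta> powr p) * J"
    using \<delta> L by (intro add_mono) (auto simp: ennreal_leI simp flip: ennreal_mult)
  finally have A: "ennreal A \<le> ennreal (A / 2) + ennreal (M\<^sup>2 / \<delta> powr p) * J" .
  have "ennreal (\<delta> powr p * (A / (2 * M\<^sup>2))) \<le> J"
  proof (cases J)
    case (real r)
    with A I have "A \<le> A / 2 + M\<^sup>2 / \<delta> powr p * r"
      by (simp flip: ennreal_mult ennreal_plus)
    then show ?thesis using real \<delta> M by (auto intro!: ennreal_leI simp: field_simps)
  qed simp
  then have "ennreal ((\<delta> powr p * (A / (2 * M\<^sup>2))) powr (1 / p)) \<le> Lp_norm p f"
    unfolding J_def using p I by (intro Lp_norm_ge) auto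
  moreover have "\<delta> * min 1 (A / (2 * M\<^sup>2)) \<le> (\<delta> powr p * (A / (2 * M\<^sup>2))) powr (1 / p)"
  proof -
    have "(\<delta> powr p * B) powr (1 / p) = \<delta> * B powr (1 / p)" if "B > 0" for B
      using that p \<delta>(1) by (simp add: powr_mult powr_powr)
    moreover have "A / (2 * M\<^sup>2) > 0" using I M by simp
    ultimately show ?thesis
      using powr_inverse_bounds(1)[of "A / (2 * M\<^sup>2)" p] p \<delta>(1)
      by (simp only:) (rule mult_left_mono, auto)
  qed
  ultimately show "ennreal (\<delta> * min 1 (A / (2 * M\<^sup>2))) \<le> Lp_norm p f"
    by (meson ennreal_leI order.trans)
qed

lemma Lp_norm_nonzero:
  assumes "p > 0" and [measurable]: "f \<in> borel_measurable borel"
    and I: "(\<integral>\<^sup>+x. ennreal ((cmod (f x))\<^sup>2) \<partial>lborel) \<noteq> 0"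
  shows "Lp_norm p f \<noteq> 0"
proof
  assume "Lp_norm p f = 0"
  then have "(\<integral>\<^sup>+x. ennreal (cmod (f x) powr p) \<partial>lborel) = 0"
    using assms(1) by (auto simp: Lp_norm_def Let_def enn2real_eq_0_iff split: if_splits)
  then have "AE x in lborel. f x = 0"
    by (subst (asm) nn_integral_0_iff_AE) auto
  then have "(\<integral>\<^sup>+x. ennreal ((cmod (f x))\<^sup>2) \<partial>lborel) = 0"
    by (subst nn_integral_0_iff_AE) auto
  with I show False by simp
qed

section \<open>The undispersed datum: integrability and nonvanishing\<close>

lemma integrable_inverse_1_plus_square: "integrable lborel (\<lambda>s::real. 1 / (1 + s\<^sup>2))"
proof -
  have pos: "1 + x\<^sup>2 > 0" for x :: real by (simp add: add_pos_nonneg)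
  have "set_integrable lborel (einterval (- \<infinity>) \<infinity>) (\<lambda>s::real. 1 / (1 + s\<^sup>2))"
  proof (rule interval_integral_FTC_nonneg(1)[where F=arctan])
    show "((arctan \<circ> real_of_ereal) \<longlongrightarrow> - (pi / 2)) (at_right (- \<infinity>))"
      using tendsto_arctan_at_bot by (simp add: ereal_tendsto_simps)
    show "((arctan \<circ> real_of_ereal) \<longlongrightarrow> pi / 2) (at_left \<infinity>)"
      using tendsto_arctan_at_top by (simp add: ereal_tendsto_simps)
  qed (auto intro!: derivative_eq_intros continuous_intros AE_I2
        simp: divide_inverse less_imp_neq[OF pos, symmetric])
  then show ?thesis by (simp add: set_integrable_def)
qed

text \<open>At parameter 0 nothing couples the coordinates, so the transform is a product of
  one-dimensional ones. The shift by 2 contributes only a unimodular factor, and each remaining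
  factor decays quadratically.\<close>

lemma norm_inv_fourier_bump_prod_le:
  fixes e e2 x :: "'a::euclidean_space"
  assumes e: "e \<in> Basis"
  shows "cmod (inv_fourier (model_sym e e2 0) x) \<le> (\<Prod>b\<in>Basis. 16 / (1 + (2 * pi * (x \<bullet> b))\<^sup>2))"
proof -
  let ?P = "\<Prod>b\<in>Basis - {e}. bump_osc 0 (2 * pi * (x \<bullet> b))"
  let ?y = "2 * pi * (x \<bullet> e)"
  let ?u = "\<lambda>t. of_real (bump (t - 2)) * exp (\<i> * of_real (?y * t)) :: complex"
  have "?u (2 + 1 *\<^sub>R s) = exp (\<i> * of_real (?y * 2)) * (of_real (bump s) * quad_exp 0 ?y s)" for s
    by (simp add: quad_exp_def distrib_left exp_add)
  moreover have "(\<integral>t. ?u t \<partial>lborel) = \<bar>1\<bar> ^ DIM(real) *\<^sub>R (\<integral>s. ?u (2 + 1 *\<^sub>R s) \<partial>lborel)"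
    by (intro lborel_integral_affine) auto
  ultimately have u: "(\<integral>t. ?u t \<partial>lborel) = exp (\<i> * of_real (?y * 2)) * bump_osc 0 ?y"
    by (simp only: integral_mult_right_zero bump_osc_def) simp
  have "inv_fourier (model_sym e e2 0) x = (\<integral>t. ?u t * ?P \<partial>lborel)"
    unfolding inv_fourier_model_sym[OF e] by (simp cong: if_cong)
  also have "\<dots> = exp (\<i> * of_real (?y * 2)) * bump_osc 0 ?y * ?P"
    by (simp only: integral_mult_left_zero u)
  finally have "cmod (inv_fourier (model_sym e e2 0) x) = (\<Prod>b\<in>Basis. cmod (bump_osc 0 (2 * pi * (x \<bullet> b))))"
    using e by (simp add: norm_mult prod_norm prod.remove[of Basis e])
  also have "\<dots> \<le> (\<Prod>b\<in>Basis. 16 / (1 + (2 * pi * (x \<bullet> b))\<^sup>2))"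
    by (intro prod_mono) (auto intro: bump_osc_decay)
  finally show ?thesis .
qed

text \<open>Supplies the L1 endpoint, needed for bounds that stay uniform as p approaches 1.\<close>

lemma nn_integral_inv_fourier_bump_prod_finite:
  fixes e e2 :: "'a::euclidean_space"
  assumes e: "e \<in> Basis"
  shows "(\<integral>\<^sup>+x. ennreal (cmod (inv_fourier (model_sym e e2 0) x)) \<partial>lborel) < \<infinity>"
proof -
  have pos: "0 \<le> (\<Prod>b\<in>Basis. 16 / (1 + (2 * pi * (x \<bullet> b))\<^sup>2))" for x :: 'a
    by (intro prod_nonneg) auto
  let ?f = "\<lambda>s. complex_of_real (16 / (1 + (2 * pi * s)\<^sup>2))"
  have "integrable lborel (\<lambda>s. complex_of_real (1 / (1 + s\<^sup>2)))"
    using integrable_inverse_1_plus_square by (simp only: complex_of_real_integrable_eq)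
  from integrable_lborel_affine[OF _ this, of "2 * pi" 0]
  have "integrable lborel (\<lambda>s. 16 * complex_of_real (1 / (1 + (2 * pi * s)\<^sup>2)))"
    by (intro integrable_mult_right) (simp del: of_real_divide)
  then have "integrable lborel ?f" by simp
  from integrable_lborel_prod[of "\<lambda>_. ?f", OF this]
  have "integrable lborel (\<lambda>x::'a. \<Prod>b\<in>Basis. 16 / (1 + (2 * pi * (x \<bullet> b))\<^sup>2))"
    by (simp only: of_real_prod[symmetric] complex_of_real_integrable_eq)
  then have "(\<integral>\<^sup>+x. ennreal (\<Prod>b\<in>Basis. 16 / (1 + (2 * pi * ((x::'a) \<bullet> b))\<^sup>2)) \<partial>lborel) < \<infinity>"
    unfolding integrable_iff_bounded using pos by simp
  then show ?thesis
    by (rule le_less_trans[rotated])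
       (intro nn_integral_mono ennreal_leI norm_inv_fourier_bump_prod_le e)
qed

text \<open>A zero integral would make the closed zero set of full measure, hence the whole space by
  continuity.\<close>

lemma integral_bump_prod_square_pos:
  fixes e :: "'a::euclidean_space"
  shows "(\<integral>x. (bump_prod e x)\<^sup>2 \<partial>lborel) > 0"
proof -
  have meas [measurable]: "bump_prod e \<in> borel_measurable borel"
    using integrable_bump_prod[of e] by auto
  have cont: "continuous_on UNIV (bump_prod e)"
    unfolding bump_prod_def[abs_def] by (intro continuous_intros)
  have int: "integrable lborel (\<lambda>x. (bump_prod e x)\<^sup>2)"
    using square_integrable_bounded[OF integrable_model_sym[of e e 0], of 1]
    by (simp add: norm_model_sym bump_prod_bounds)
  have "(\<integral>x. (bump_prod e x)\<^sup>2 \<partial>lborel) \<noteq> 0"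
  proof
    assume "(\<integral>x. (bump_prod e x)\<^sup>2 \<partial>lborel) = 0"
    then have "AE x in lborel. bump_prod e x = 0"
      by (subst (asm) integral_nonneg_eq_0_iff_AE[OF int]) auto
    then have "AE x\<in>UNIV in lebesgue. x \<in> {x. bump_prod e x = 0}"
      by (auto intro: AE_completion)
    moreover have "closed {x. bump_prod e x = 0}"
      using cont by (intro closed_Collect_eq) auto
    ultimately have "bump_prod e x = 0" for x
      using mem_closed_if_AE_lebesgue_open[of UNIV "{x. bump_prod e x = 0}" x] by auto
    \<comment> \<open>The centre of the support, where every factor is \<open>bump 0\<close> = 1;
      without a shifted coordinate it is the origin.\<close>
    from this[of "2 *\<^sub>R (if e \<in> Basis then e else 0)"] show False
      by (auto simp: bump_prod_def bump_def inner_Basis split: if_splits)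
  qed
  moreover have "(\<integral>x. (bump_prod e x)\<^sup>2 \<partial>lborel) \<ge> 0" by simp
  ultimately show ?thesis by linarith
qed

text \<open>Each pair of model functions is admissible in the supremum: inversion provides their L2
  transforms, the group law links them, and Plancherel shows that the datum is nonzero.\<close>

lemma multiplier_norm_model_ge:
  fixes e e2 :: "'a::euclidean_space"
  assumes e: "e \<in> Basis" and p: "p > 0"
    and fin: "Lp_norm p (inv_fourier (model_sym e e2 k)) \<le> ennreal y"
    and ge: "ennreal x \<le> Lp_norm p (inv_fourier (model_sym e e2 (l + k)))"
    and xy: "0 \<le> x" "0 < y"
  shows "ennreal (x / y) \<le> multiplier_norm p (phase_symbol (phase_fun e e2) l)"
proof -
  let ?f = "inv_fourier (model_sym e e2 k)" and ?g = "inv_fourier (model_sym e e2 (l + k))"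
  have F: "fourier_L2 (inv_fourier (model_sym e e2 j)) (model_sym e e2 j)" for j
    by (rule fourier_L2_inv_fourier[where K=1])
       (auto intro: continuous_on_model_sym integrable_model_sym simp: norm_model_sym bump_prod_bounds)
  have mult: "fourier_multiplier (phase_symbol (phase_fun e e2) l) ?f ?g"
    unfolding fourier_multiplier_def
    using F[of k] F[of "l + k"] by (intro exI[of _ "model_sym e e2 k"]) (simp add: phase_symbol_model_sym[OF e])
  have f2: "?f \<in> Lp_space 2" using F[of k] by (simp add: fourier_L2_def)
  then have m: "?f \<in> borel_measurable borel" by (simp add: Lp_space_def)
  have fp: "?f \<in> Lp_space p"
    using m le_less_trans[OF fin ennreal_less_top] by (simp add: Lp_space_def)
  have "(\<integral>\<^sup>+x. ennreal ((cmod (?f x))\<^sup>2) \<partial>lborel) \<noteq> 0"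
    using Plancherel_inv_fourier[OF continuous_on_model_sym integrable_model_sym, of e e2 k 1]
      integral_bump_prod_square_pos[of e]
    by (simp add: norm_model_sym bump_prod_bounds)
  from Lp_norm_nonzero[OF p m this] have nz: "Lp_norm p ?f \<noteq> 0" .
  have "ennreal (x / y) \<le> Lp_norm p ?g / Lp_norm p ?f"
    by (rule ennreal_div_mono[OF ge fin nz xy])
  also have "\<dots> \<le> multiplier_norm p (phase_symbol (phase_fun e e2) l)"
    unfolding multiplier_norm_def using f2 fp nz mult by (intro Sup_upper) auto
  finally show ?thesis .
qed

section \<open>Assembly of the constants and the two ranges of p\<close>

lemma multiplier_norm_phase_fun_ge:
  fixes e e2 :: "'a::euclidean_space"
  assumes e: "e \<in> Basis" "e2 \<in> Basis" "e2 \<noteq> e"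
  obtains C where "C > 0" "\<And>p l. 1 < p \<Longrightarrow> l \<noteq> 0 \<Longrightarrow>
    ennreal (C * \<bar>l\<bar> powr (real DIM('a) * \<bar>1 / 2 - 1 / p\<bar>)) \<le>
      multiplier_norm p (phase_symbol (phase_fun e e2) l)"
proof -
  let ?g = "\<lambda>l. inv_fourier (model_sym e e2 l)"
  define A where "A = (\<integral>x. (bump_prod e x)\<^sup>2 \<partial>lborel)"
  define M where "M = max 1 (\<integral>x. bump_prod e x \<partial>lborel)"
  define L where "L = enn2real (\<integral>\<^sup>+x. ennreal (cmod (?g 0 x)) \<partial>lborel) + 1"
  define K where "K = 144 * pi * 60 ^ (DIM('a) - 2)"
  \<comment> \<open>Bounds L^(1/p) M^(1-1/p) for every p > 1, using M \<ge> 1; the 1 added in L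
    keeps it positive.\<close>
  define U where "U = max 1 L * M"
  have A: "A > 0" unfolding A_def by (rule integral_bump_prod_square_pos)
  have M: "M \<ge> 1" by (simp add: M_def)
  have L: "L > 0" by (simp add: L_def add_nonneg_pos)
  have U: "U > 0" using M by (simp add: U_def)
  have K: "K \<ge> 1"
  proof -
    have "1 * 1 \<le> (144 * pi) * 60 ^ (DIM('a) - 2)"
      using pi_ge_two by (intro mult_mono one_le_power) auto
    then show ?thesis by (simp add: K_def)
  qed
  have meas [measurable]: "?g l \<in> borel_measurable borel" for l
    using borel_measurable_continuous_onI[OF continuous_on_model_sym[of e e2 l]] by simp
  have P: "(\<integral>\<^sup>+x. ennreal ((cmod (?g l x))\<^sup>2) \<partial>lborel) = ennreal A" for l
    using Plancherel_inv_fourier[OF continuous_on_model_sym integrable_model_sym, of e e2 l 1]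
    by (simp add: norm_model_sym bump_prod_bounds A_def)
  have gM: "cmod (?g l x) \<le> M" for l x
    using norm_inv_fourier_le[of "model_sym e e2 l" x] by (simp add: norm_model_sym M_def)
  have gL: "(\<integral>\<^sup>+x. ennreal (cmod (?g 0 x)) \<partial>lborel) \<le> ennreal L"
    using nn_integral_inv_fourier_bump_prod_finite[OF e(1), of e2] unfolding L_def
    by (cases "\<integral>\<^sup>+x. ennreal (cmod (?g 0 x)) \<partial>lborel") (auto intro!: ennreal_leI)
  have disp: "cmod (?g l x) \<le> K * \<bar>l\<bar> powr (- (real DIM('a) / 2))" if "l \<noteq> 0" for l x
    unfolding K_def by (rule inv_fourier_model_sym_bound[OF e that])
  obtain \<beta> where \<beta>: "\<beta> > 0" "\<And>p. p \<ge> 1 \<Longrightarrow> ennreal \<beta> \<le> Lp_norm p (?g 0)"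
    using Lp_norm_lower_uniform[of M "?g 0" L A] M gM gL L P A by (metis less_imp_le less_le_trans meas zero_less_one)
  \<comment> \<open>The first entry serves p \<le> 2 and the second p > 2.\<close>
  define C where "C = min (min 1 A / K / U) (\<beta> / (max 1 A * K))"
  have C: "C > 0" using A K U \<beta> by (simp add: C_def)
  show ?thesis
  proof (rule that[OF C])
    fix p l :: real assume p: "1 < p" and l: "l \<noteq> 0"
    \<comment> \<open>The interpolation exponent of the sup norm against L2. It stays in [-1,1], so
      K^s lies between 1/K and K whatever p is.\<close>
    define s where "s = 1 - 2 / p"
    define N where "N = K * \<bar>l\<bar> powr (- (real DIM('a) / 2))"
    have N: "N > 0" using K l by (simp add: N_def)
    have s: "- 1 \<le> s" "s \<le> 1" using p by (auto simp: s_def field_simps)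
    have Ns: "N powr s = K powr s * \<bar>l\<bar> powr (real DIM('a) * (1 / p - 1 / 2))"
    proof -
      have "- (real DIM('a) / 2) * s = real DIM('a) * (1 / p - 1 / 2)"
        by (simp add: s_def field_simps)
      then show ?thesis using K by (simp only: N_def powr_powr powr_mult)
    qed
    note Ap = powr_inverse_bounds[OF A less_imp_le[OF p]]
    show "ennreal (C * \<bar>l\<bar> powr (real DIM('a) * \<bar>1 / 2 - 1 / p\<bar>)) \<le>
      multiplier_norm p (phase_symbol (phase_fun e e2) l)"
    proof (cases "p \<le> 2")
      case True
      \<comment> \<open>For p \<le> 2 the datum is undispersed with norm at most U, and its image is
        dispersed and therefore large in Lp.\<close>
      have "Lp_norm p (?g 0) \<le> ennreal (L powr (1 / p) * M powr (1 - 1 / p))"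
        using p M L gM gL by (intro Lp_norm_upper_interpolation) auto
      also have "L powr (1 / p) * M powr (1 - 1 / p) \<le> U"
        unfolding U_def
      proof (intro mult_mono)
        show "L powr (1 / p) \<le> max 1 L" using p by (intro powr_inverse_bounds L) simp
        show "M powr (1 - 1 / p) \<le> M" using powr_mono[of "1 - 1 / p" 1 M] M p by simp
      qed auto
      finally have f: "Lp_norm p (?g 0) \<le> ennreal U" by (simp add: ennreal_leI)
      have "ennreal (A powr (1 / p) * N powr s) \<le> Lp_norm p (?g (l + 0))"
        unfolding s_def using p True N A P disp[OF l]
        by (intro Lp_norm_lower_interpolation) (auto simp: N_def)
      from multiplier_norm_model_ge[OF e(1) _ f this] p U
      have "ennreal (A powr (1 / p) * N powr s / U) \<le> multiplier_norm p (phase_symbol (phase_fun e e2) l)"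
        by simp
      moreover have "C * \<bar>l\<bar> powr (real DIM('a) * \<bar>1 / 2 - 1 / p\<bar>) \<le> A powr (1 / p) * N powr s / U"
      proof -
        have "1 / p - 1 / 2 \<ge> 0" using True p by (simp add: field_simps)
        then have eq: "\<bar>1 / 2 - 1 / p\<bar> = 1 / p - 1 / 2" by simp
        have "1 / K = K powr (- 1)" using K by (simp add: powr_minus_divide)
        also have "\<dots> \<le> K powr s" using K s by (intro powr_mono) auto
        finally have "min 1 A * (1 / K) \<le> A powr (1 / p) * K powr s"
          using Ap K A by (intro mult_mono) auto
        then have "min 1 A / K / U \<le> A powr (1 / p) * K powr s / U"
          using U by (intro divide_right_mono) auto
        then have "C \<le> A powr (1 / p) * K powr s / U" unfolding C_def by linarith
        from mult_right_mono[OF this, of "\<bar>l\<bar> powr (real DIM('a) * (1 / p - 1 / 2))"]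
        show ?thesis by (simp add: Ns eq mult_ac)
      qed
      ultimately show ?thesis by (meson ennreal_leI order.trans)
    next
      case False
      \<comment> \<open>For p > 2 the roles are reversed: the datum is dispersed and small in Lp,
        and the multiplier refocuses it to the undispersed function, whose norm is at least
        \<beta>.\<close>
      have "Lp_norm p (?g (- l)) \<le> ennreal (A powr (1 / p) * N powr s)"
        unfolding s_def using False N A P disp[of "- l"] l
        by (intro Lp_norm_upper_interpolation) (auto simp: N_def)
      moreover have "ennreal \<beta> \<le> Lp_norm p (?g (l + - l))" using \<beta> p by simp
      ultimately have "ennreal (\<beta> / (A powr (1 / p) * N powr s)) \<le>
          multiplier_norm p (phase_symbol (phase_fun e e2) l)"
        using p \<beta> A N by (intro multiplier_norm_model_ge[OF e(1)]) auto
      moreover have "C * \<bar>l\<bar> powr (real DIM('a) * \<bar>1 / 2 - 1 / p\<bar>) \<le> \<beta> / (A powr (1 / p) * N powr s)"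
      proof -
        let ?E = "\<bar>l\<bar> powr (real DIM('a) * (1 / 2 - 1 / p))"
        have "1 / 2 - 1 / p \<ge> 0" using False by (simp add: field_simps)
        then have eq: "\<bar>1 / 2 - 1 / p\<bar> = 1 / 2 - 1 / p" by simp
        have "real DIM('a) * (1 / p - 1 / 2) = - (real DIM('a) * (1 / 2 - 1 / p))"
          by (simp add: algebra_simps)
        then have inv: "\<bar>l\<bar> powr (real DIM('a) * (1 / p - 1 / 2)) = 1 / ?E"
          by (simp only: powr_minus_divide)
        have "K powr s \<le> K" using powr_mono[OF s(2), of K] K by simp
        then have "A powr (1 / p) * K powr s \<le> max 1 A * K"
          using Ap K A by (intro mult_mono) auto
        then have "\<beta> / (max 1 A * K) \<le> \<beta> / (A powr (1 / p) * K powr s)"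
          using \<beta> A K by (intro divide_left_mono mult_pos_pos) auto
        then have "C \<le> \<beta> / (A powr (1 / p) * K powr s)" unfolding C_def by linarith
        from mult_right_mono[OF this, of ?E]
        show ?thesis by (simp add: Ns eq inv)
      qed
      ultimately show ?thesis by (meson ennreal_leI order.trans)
    qed
  qed
qed

theorem proposition1:
  assumes "CARD('n::finite) \<ge> 2"
  shows "\<exists>(\<phi> :: real ^ 'n \<Rightarrow> real) (C :: real) (l\<^sub>0 :: real).
           smooth_on (sphere 0 1) \<phi> \<and> C > 0 \<and> l\<^sub>0 > 0 \<and>
           (\<forall>(p :: real) (l :: real). 1 < p \<longrightarrow> \<bar>l\<bar> \<ge> l\<^sub>0 \<longrightarrow>
              multiplier_norm p (phase_symbol \<phi> l)
                \<ge> ennreal (C * \<bar>l\<bar> powr (real CARD('n) * \<bar>1 / 2 - 1 / p\<bar>)))"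
proof -
  have "card (Basis :: (real ^ 'n) set) \<ge> 2" using assms by simp
  then obtain e e2 :: "real ^ 'n" where e: "e \<in> Basis" "e2 \<in> Basis" "e2 \<noteq> e"
    by (metis card_2_iff' card_le_Suc0_iff_eq finite_Basis not_less_eq_eq numeral_2_eq_2)
  from multiplier_norm_phase_fun_ge[OF this] obtain C where "C > 0"
    and "\<And>p l. 1 < p \<Longrightarrow> l \<noteq> 0 \<Longrightarrow>
      ennreal (C * \<bar>l\<bar> powr (real CARD('n) * \<bar>1 / 2 - 1 / p\<bar>)) \<le>
        multiplier_norm p (phase_symbol (phase_fun e e2) l)"
    by auto
  then show ?thesis
    \<comment> \<open>The estimate holds for every nonzero parameter, so the threshold is taken to
      be 1.\<close>
    by (intro exI[of _ "phase_fun e e2"] exI[of _ C] exI[of _ 1]) (auto intro: smooth_on_phase_fun)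
qed

end
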